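(* Let $(A,\cdot,[\cdot,\cdot,\cdot])$ be a (finite-dimensional) admissible transposed Poisson 3-Lie algebra over a field $\mathbb F$ of characteristic zero and let $(A,\Delta,\delta)$ be an admissible transposed Poisson 3-Lie coalgebra on the same vector space. Let $(A^*,\circ,[\cdot,\cdot,\cdot]^* )$ be the admissible transposed Poisson 3-Lie algebra on $A^*$ with $\circ=\Delta^*$ and $[\cdot,\cdot,\cdot]^*=\delta^*$. Then $(A,A^*,\mathrm{ad}^*,-\mathcal L^*,\mathfrak{ad}^*,-L^* )$ is a matched pair of admissible transposed Poisson 3-Lie algebras if and only if $(A,\cdot,[\cdot,\cdot,\cdot],\Delta,\delta)$ is a double construction admissible transposed Poisson 3-Lie bialgebra.
   Context: All vector spaces are finite-dimensional over a field $\mathbb F$ of characteristic zero; no unit is assumed in algebras; $\langle\cdot,\cdot\rangle$ is the pairing between a space and its dual (extended factorwise to tensor powers), and $(A^* )^*=A$. 3-Lie algebra: vector space with a skew-symmetric trilinear bracket satisfying $[x_1,x_2,[x_3,x_4,x_5]]=[[x_1,x_2,x_3],x_4,x_5]+[x_3,[x_1,x_2,x_4],x_5]+[x_3,x_4,[x_1,x_2,x_5]]$. Admissible transposed Poisson 3-Lie algebra $(A,\cdot,[\cdot,\cdot,\cdot])$: $(A,\cdot)$ commutative associative, $(A,[\cdot,\cdot,\cdot])$ a 3-Lie algebra, and $u\cdot[x,y,z]=[u\cdot x,y,z]=0$ for all $x,y,z,u\in A$. Representations. A representation of a commutative associative algebra $(A,\cdot)$ on $V$: linear $\mu:A\to\mathfrak{gl}(V)$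 with $\mu(x\cdot y)=\mu(x)\mu(y)$. A representation of a 3-Lie algebra on $V$: a skew-symmetric linear $\rho:\otimes^2A\to\mathfrak{gl}(V)$ with $\rho(x_1,x_2)\rho(x_3,x_4)-\rho(x_3,x_4)\rho(x_1,x_2)=\rho([x_1,x_2,x_3],x_4)-\rho([x_1,x_2,x_4],x_3)$ and $\rho([x_1,x_2,x_3],x_4)=\rho(x_1,x_2)\rho(x_3,x_4)+\rho(x_2,x_3)\rho(x_1,x_4)+\rho(x_3,x_1)\rho(x_2,x_4)$. A representation $(V,\rho,\mu)$ of an admissible transposed Poisson 3-Lie algebra: both of these together with $\mu(x)\rho(y,z)=\rho(y,z)\mu(x)=\rho(x\cdot y,z)=\mu([x,y,z])=0$ for all $x,y,z$. Duals: $\langle\rho^*(x_1,x_2)\xi,v\rangle=-\langle\xi,\rho(x_1,x_2)v\rangle$, $\langle\mu^*(x)\xi,v\rangle=-\langle\xi,\mu(x)v\rangle$. On $A$: $\mathrm{ad}_{x,y}z=[x,y,z]$, $\mathcal L(x)y=\mathcal L_xy=x\cdot y$. On $A^*$: $\mathfrak{ad}_{\xi,\eta}\zeta=[\xi,\eta,\zeta]^*$, $L(\xi)\eta=\xi\circ\eta$. So $\mathrm{ad}^*:\otimes^2A\to\mathfrak{gl}(A^* )$, $\mathcal L^*:A\to\mathfrak{gl}(A^* )$, $\mathfrak{ad}^*:\otimes^2A^*\to\mathfrak{gl}(A)$, $L^*:A^*\to\mathfrak{gl}(A)$. Matched pair of commutative associative algebras $(A,B,\mu_A,\mu_B)$: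 $(B,\mu_A)$, $(A,\mu_B)$ are representations of $(A,\cdot_A)$, $(B,\cdot_B)$ and, for $x,y\in A$, $a,b\in B$, $\mu_A(x)(a\cdot_Bb)=(\mu_A(x)a)\cdot_Bb+\mu_A(\mu_B(a)x)b$ and $\mu_B(a)(x\cdot_Ay)=(\mu_B(a)x)\cdot_Ay+\mu_B(\mu_A(x)a)y$. Matched pair of 3-Lie algebras $(A,B,\rho_A,\rho_B)$: $(B,\rho_A)$, $(A,\rho_B)$ are representations of the 3-Lie algebras $A$, $B$ and for $x_i\in A$, $y_i\in B$: $\rho_B(y_4,y_5)[x_1,x_2,x_3]_A=[\rho_B(y_4,y_5)x_1,x_2,x_3]_A+[x_1,\rho_B(y_4,y_5)x_2,x_3]_A+[x_1,x_2,\rho_B(y_4,y_5)x_3]_A$; $-\rho_B(\rho_A(x_1,x_2)y_3,y_5)x_4=-\rho_B(\rho_A(x_1,x_4)y_5,y_3)x_2+\rho_B(\rho_A(x_2,x_4)y_5,y_3)x_1-[x_1,x_2,\rho_B(y_3,y_5)x_4]_A$; $[\rho_B(y_2,y_3)x_1,x_4,x_5]_A=\rho_B(y_2,y_3)[x_1,x_4,x_5]_A+\rho_B(\rho_A(x_4,x_5)y_2,y_3)x_1+\rho_B(y_2,\rho_A(x_4,x_5)y_3)x_1$; and the three identities obtained by exchanging the roles of $A$ and $B$ (i.e. $x\leftrightarrow y$, $A\leftrightarrow B$). Matched pair of admissible transposed Poisson 3-Lie algebras $(A,B,\rho_A,\mu_A,\rho_B,\mu_B)$ ($A,B$ admissible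 transposed Poisson 3-Lie algebras): $(A,B,\mu_A,\mu_B)$ is a matched pair of commutative associative algebras, $(A,B,\rho_A,\rho_B)$ is a matched pair of 3-Lie algebras, $(B,\rho_A,\mu_A)$ and $(A,\rho_B,\mu_B)$ are representations of the admissible transposed Poisson 3-Lie algebras $A$ and $B$, and for all $x_i\in A$, $y_i\in B$: $\mu_B(y_4)[x_1,x_2,x_3]_A=\rho_A(x_1,x_2)(y_4\cdot_By_3)=0$; $\mu_A(x_4)[y_1,y_2,y_3]_B=\rho_B(y_1,y_2)(x_4\cdot_Ax_3)=0$; $\mu_B(\rho_A(x_2,x_3)y_1)x_4=0$; $\mu_A(\rho_B(y_2,y_3)x_1)y_4=0$; $[\mu_B(y_1)x_4,x_2,x_3]_A=0$; $[\mu_A(x_1)y_4,y_2,y_3]_B=0$; $\rho_A(\mu_B(y_4)x_1,x_2)y_3+\rho_B(y_3,\mu_A(x_1)y_4)x_2=0$ (an identity in $A\oplus B$). Coalgebras. $\Delta^*:A^*\otimes A^*\to A^*$ and $\delta^*:\otimes^3A^*\to A^*$ are the transposes of $\Delta:A\to A\otimes A$ and $\delta:A\to\otimes^3A$. $\tau_{ij}$ swaps the $i$-th and $j$-th tensor factors, $\tau$ is the flip on $A\otimes A$. Cocommutative coassociative coalgebra: $\tau\Delta=\Delta$, $(\Delta\otimes1)\Delta=(1\otimes\Delta)\Delta$. 3-Lie coalgebra $(A,\delta)$: $\delta^*$ is skew-symmetric and $(\delta\otimes1\otimes1)\delta(x)+\tau_{23}\tau_{12}((1\otimes\delta\otimes1)\delta(x))+\tau_{13}\tau_{24}((1\otimes1\otimes\delta)\delta(x))=(1\otimes1\otimes\delta)\delta(x)$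 (equivalently, $\delta^*$ is a 3-Lie bracket on $A^*$). Admissible transposed Poisson 3-Lie coalgebra $(A,\Delta,\delta)$: $(A,\Delta)$ cocommutative coassociative, $(A,\delta)$ a 3-Lie coalgebra, and $(\Delta\otimes1\otimes1)\delta(x)=(1\otimes\delta)\Delta(x)=0$ for all $x$; then $(A^*,\Delta^*,\delta^* )$ is an admissible transposed Poisson 3-Lie algebra. Bialgebras. Commutative and cocommutative infinitesimal bialgebra $(A,\cdot,\Delta)$: $(A,\cdot)$ commutative associative, $(A,\Delta)$ cocommutative coassociative, $\Delta(x\cdot y)=(\mathcal L_x\otimes1)\Delta(y)+(1\otimes\mathcal L_y)\Delta(x)$. Double construction 3-Lie bialgebra $(A,[\cdot,\cdot,\cdot],\delta)$: a 3-Lie algebra and 3-Lie coalgebra with $\delta([x,y,z])=(1\otimes1\otimes\mathrm{ad}_{y,z})\delta(x)+(1\otimes1\otimes\mathrm{ad}_{z,x})\delta(y)+(1\otimes1\otimes\mathrm{ad}_{x,y})\delta(z)$ and $\delta([x,y,z])=(1\otimes1\otimes\mathrm{ad}_{y,z})\delta(x)+(1\otimes\mathrm{ad}_{y,z}\otimes1)\delta(x)+(\mathrm{ad}_{y,z}\otimes1\otimes1)\delta(x)$. Double construction admissible transposed Poisson 3-Lie bialgebra $(A,\cdot,[\cdot,\cdot,\cdot],\Delta,\delta)$: an admissible transposed Poisson 3-Lie algebra and admissible transposed Poisson 3-Lie coalgebra such that $(A,[\cdot,\cdot,\cdot],\delta)$ is a double construction 3-Lie bialgebra, $(A,\cdot,\Delta)$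 is a commutative and cocommutative infinitesimal bialgebra, and for all $x,y,z\in A$: $\Delta([x,y,z])=0$, $\delta(x\cdot y)=0$, $(\mathrm{ad}_{y,z}\otimes1)\Delta(x)=0$, $(1\otimes1\otimes\mathcal L(y))\delta(x)=0$, $(1\otimes\mathrm{ad}_{y,z})\Delta(x)=0$, $(\mathcal L(y)\otimes1\otimes1)\delta(x)=0$. *)

theory Defs
  imports Complex_Main "HOL-Library.Function_Algebras"
begin

text \<open>A vector space over the field \<^typ>\<open>'f\<close> is a subspace \<open>V\<close> (the carrier) of a type with scalar
  multiplication \<open>s\<close>. Operations are total functions on the ambient type; every axiom is
  relativised to the carrier.\<close>

definition vspace :: "('f::field \<Rightarrow> 'v::ab_group_add \<Rightarrow> 'v) \<Rightarrow> 'v set \<Rightarrow> bool" where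
  "vspace s V \<longleftrightarrow> vector_space s \<and> module.subspace s V"

definition linear_on ::
  "('f::field \<Rightarrow> 'v::ab_group_add \<Rightarrow> 'v) \<Rightarrow> 'v set \<Rightarrow> ('f \<Rightarrow> 'w::ab_group_add \<Rightarrow> 'w) \<Rightarrow> 'w set
    \<Rightarrow> ('v \<Rightarrow> 'w) \<Rightarrow> bool" where
  "linear_on s V t W f \<longleftrightarrow>
     (\<forall>x\<in>V. f x \<in> W) \<and>
     (\<forall>x\<in>V. \<forall>y\<in>V. f (x + y) = f x + f y) \<and>
     (\<forall>c. \<forall>x\<in>V. f (s c x) = t c (f x))"


section \<open>Algebras\<close>

definition comm_assoc_algebra ::
  "('f::field \<Rightarrow> 'v::ab_group_add \<Rightarrow> 'v) \<Rightarrow> 'v set \<Rightarrow> ('v \<Rightarrow> 'v \<Rightarrow> 'v) \<Rightarrow> bool" where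
  "comm_assoc_algebra s V m \<longleftrightarrow>
     vspace s V \<and>
     (\<forall>x\<in>V. linear_on s V s V (\<lambda>y. m x y)) \<and>
     (\<forall>y\<in>V. linear_on s V s V (\<lambda>x. m x y)) \<and>
     (\<forall>x\<in>V. \<forall>y\<in>V. m x y = m y x) \<and>
     (\<forall>x\<in>V. \<forall>y\<in>V. \<forall>z\<in>V. m (m x y) z = m x (m y z))"

definition trilinear_on ::
  "('f::field \<Rightarrow> 'v::ab_group_add \<Rightarrow> 'v) \<Rightarrow> 'v set \<Rightarrow> ('v \<Rightarrow> 'v \<Rightarrow> 'v \<Rightarrow> 'v) \<Rightarrow> bool" where
  "trilinear_on s V br \<longleftrightarrow>
     (\<forall>y\<in>V. \<forall>z\<in>V. linear_on s V s V (\<lambda>x. br x y z)) \<and>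
     (\<forall>x\<in>V. \<forall>z\<in>V. linear_on s V s V (\<lambda>y. br x y z)) \<and>
     (\<forall>x\<in>V. \<forall>y\<in>V. linear_on s V s V (\<lambda>z. br x y z))"

definition skew3_on :: "'v set \<Rightarrow> ('v \<Rightarrow> 'v \<Rightarrow> 'v \<Rightarrow> 'v::ab_group_add) \<Rightarrow> bool" where
  "skew3_on V br \<longleftrightarrow>
     (\<forall>x\<in>V. \<forall>y\<in>V. \<forall>z\<in>V. br y x z = - br x y z \<and> br x z y = - br x y z)"

definition three_lie_algebra ::
  "('f::field \<Rightarrow> 'v::ab_group_add \<Rightarrow> 'v) \<Rightarrow> 'v set \<Rightarrow> ('v \<Rightarrow> 'v \<Rightarrow> 'v \<Rightarrow> 'v) \<Rightarrow> bool" where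
  "three_lie_algebra s V br \<longleftrightarrow>
     vspace s V \<and> trilinear_on s V br \<and> skew3_on V br \<and>
     (\<forall>x1\<in>V. \<forall>x2\<in>V. \<forall>x3\<in>V. \<forall>x4\<in>V. \<forall>x5\<in>V.
        br x1 x2 (br x3 x4 x5) =
          br (br x1 x2 x3) x4 x5 + br x3 (br x1 x2 x4) x5 + br x3 x4 (br x1 x2 x5))"

definition adm_tp3_algebra ::
  "('f::field \<Rightarrow> 'v::ab_group_add \<Rightarrow> 'v) \<Rightarrow> 'v set \<Rightarrow> ('v \<Rightarrow> 'v \<Rightarrow> 'v)
    \<Rightarrow> ('v \<Rightarrow> 'v \<Rightarrow> 'v \<Rightarrow> 'v) \<Rightarrow> bool" where
  "adm_tp3_algebra s V m br \<longleftrightarrow>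
     comm_assoc_algebra s V m \<and> three_lie_algebra s V br \<and>
     (\<forall>u\<in>V. \<forall>x\<in>V. \<forall>y\<in>V. \<forall>z\<in>V. m u (br x y z) = 0 \<and> br (m u x) y z = 0)"


section \<open>Representations\<close>

definition comm_assoc_rep ::
  "('f::field \<Rightarrow> 'v::ab_group_add \<Rightarrow> 'v) \<Rightarrow> 'v set \<Rightarrow> ('v \<Rightarrow> 'v \<Rightarrow> 'v)
    \<Rightarrow> ('f \<Rightarrow> 'w::ab_group_add \<Rightarrow> 'w) \<Rightarrow> 'w set \<Rightarrow> ('v \<Rightarrow> 'w \<Rightarrow> 'w) \<Rightarrow> bool" where
  "comm_assoc_rep s V m t W \<mu> \<longleftrightarrow>
     comm_assoc_algebra s V m \<and> vspace t W \<and>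
     (\<forall>x\<in>V. linear_on t W t W (\<mu> x)) \<and>
     (\<forall>w\<in>W. linear_on s V t W (\<lambda>x. \<mu> x w)) \<and>
     (\<forall>x\<in>V. \<forall>y\<in>V. \<forall>w\<in>W. \<mu> (m x y) w = \<mu> x (\<mu> y w))"

definition three_lie_rep ::
  "('f::field \<Rightarrow> 'v::ab_group_add \<Rightarrow> 'v) \<Rightarrow> 'v set \<Rightarrow> ('v \<Rightarrow> 'v \<Rightarrow> 'v \<Rightarrow> 'v)
    \<Rightarrow> ('f \<Rightarrow> 'w::ab_group_add \<Rightarrow> 'w) \<Rightarrow> 'w set \<Rightarrow> ('v \<Rightarrow> 'v \<Rightarrow> 'w \<Rightarrow> 'w) \<Rightarrow> bool" where
  "three_lie_rep s V br t W \<rho> \<longleftrightarrow>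
     three_lie_algebra s V br \<and> vspace t W \<and>
     (\<forall>x\<in>V. \<forall>y\<in>V. linear_on t W t W (\<rho> x y)) \<and>
     (\<forall>y\<in>V. \<forall>w\<in>W. linear_on s V t W (\<lambda>x. \<rho> x y w)) \<and>
     (\<forall>x\<in>V. \<forall>w\<in>W. linear_on s V t W (\<lambda>y. \<rho> x y w)) \<and>
     (\<forall>x\<in>V. \<forall>y\<in>V. \<forall>w\<in>W. \<rho> y x w = - \<rho> x y w) \<and>
     (\<forall>x1\<in>V. \<forall>x2\<in>V. \<forall>x3\<in>V. \<forall>x4\<in>V. \<forall>w\<in>W.
        \<rho> x1 x2 (\<rho> x3 x4 w) - \<rho> x3 x4 (\<rho> x1 x2 w)
          = \<rho> (br x1 x2 x3) x4 w - \<rho> (br x1 x2 x4) x3 w \<and>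
        \<rho> (br x1 x2 x3) x4 w
          = \<rho> x1 x2 (\<rho> x3 x4 w) + \<rho> x2 x3 (\<rho> x1 x4 w) + \<rho> x3 x1 (\<rho> x2 x4 w))"

definition adm_tp3_rep ::
  "('f::field \<Rightarrow> 'v::ab_group_add \<Rightarrow> 'v) \<Rightarrow> 'v set \<Rightarrow> ('v \<Rightarrow> 'v \<Rightarrow> 'v) \<Rightarrow> ('v \<Rightarrow> 'v \<Rightarrow> 'v \<Rightarrow> 'v)
    \<Rightarrow> ('f \<Rightarrow> 'w::ab_group_add \<Rightarrow> 'w) \<Rightarrow> 'w set
    \<Rightarrow> ('v \<Rightarrow> 'v \<Rightarrow> 'w \<Rightarrow> 'w) \<Rightarrow> ('v \<Rightarrow> 'w \<Rightarrow> 'w) \<Rightarrow> bool" where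
  "adm_tp3_rep s V m br t W \<rho> \<mu> \<longleftrightarrow>
     adm_tp3_algebra s V m br \<and>
     comm_assoc_rep s V m t W \<mu> \<and> three_lie_rep s V br t W \<rho> \<and>
     (\<forall>x\<in>V. \<forall>y\<in>V. \<forall>z\<in>V. \<forall>w\<in>W.
        \<mu> x (\<rho> y z w) = 0 \<and> \<rho> y z (\<mu> x w) = 0 \<and> \<rho> (m x y) z w = 0 \<and> \<mu> (br x y z) w = 0)"


section \<open>Matched pairs\<close>

definition comm_assoc_matched_pair ::
  "('f::field \<Rightarrow> 'a::ab_group_add \<Rightarrow> 'a) \<Rightarrow> 'a set \<Rightarrow> ('a \<Rightarrow> 'a \<Rightarrow> 'a)
    \<Rightarrow> ('f \<Rightarrow> 'b::ab_group_add \<Rightarrow> 'b) \<Rightarrow> 'b set \<Rightarrow> ('b \<Rightarrow> 'b \<Rightarrow> 'b)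
    \<Rightarrow> ('a \<Rightarrow> 'b \<Rightarrow> 'b) \<Rightarrow> ('b \<Rightarrow> 'a \<Rightarrow> 'a) \<Rightarrow> bool" where
  "comm_assoc_matched_pair sA A mA sB B mB \<mu>A \<mu>B \<longleftrightarrow>
     comm_assoc_rep sA A mA sB B \<mu>A \<and> comm_assoc_rep sB B mB sA A \<mu>B \<and>
     (\<forall>x\<in>A. \<forall>a\<in>B. \<forall>b\<in>B. \<mu>A x (mB a b) = mB (\<mu>A x a) b + \<mu>A (\<mu>B a x) b) \<and>
     (\<forall>a\<in>B. \<forall>x\<in>A. \<forall>y\<in>A. \<mu>B a (mA x y) = mA (\<mu>B a x) y + \<mu>B (\<mu>A x a) y)"

text \<open>The three compatibility identities of a matched pair of 3-Lie algebras that take values in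
  \<open>A\<close>; the other three arise by exchanging the two algebras.\<close>

definition three_lie_matching ::
  "'a set \<Rightarrow> ('a \<Rightarrow> 'a \<Rightarrow> 'a \<Rightarrow> 'a::ab_group_add) \<Rightarrow> 'b set
    \<Rightarrow> ('a \<Rightarrow> 'a \<Rightarrow> 'b \<Rightarrow> 'b) \<Rightarrow> ('b \<Rightarrow> 'b \<Rightarrow> 'a \<Rightarrow> 'a) \<Rightarrow> bool" where
  "three_lie_matching A brA B \<rho>A \<rho>B \<longleftrightarrow>
     (\<forall>x1\<in>A. \<forall>x2\<in>A. \<forall>x3\<in>A. \<forall>y4\<in>B. \<forall>y5\<in>B.
        \<rho>B y4 y5 (brA x1 x2 x3) =
          brA (\<rho>B y4 y5 x1) x2 x3 + brA x1 (\<rho>B y4 y5 x2) x3 + brA x1 x2 (\<rho>B y4 y5 x3)) \<and>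
     (\<forall>x1\<in>A. \<forall>x2\<in>A. \<forall>x4\<in>A. \<forall>y3\<in>B. \<forall>y5\<in>B.
        - \<rho>B (\<rho>A x1 x2 y3) y5 x4 =
          - \<rho>B (\<rho>A x1 x4 y5) y3 x2 + \<rho>B (\<rho>A x2 x4 y5) y3 x1 - brA x1 x2 (\<rho>B y3 y5 x4)) \<and>
     (\<forall>x1\<in>A. \<forall>x4\<in>A. \<forall>x5\<in>A. \<forall>y2\<in>B. \<forall>y3\<in>B.
        brA (\<rho>B y2 y3 x1) x4 x5 =
          \<rho>B y2 y3 (brA x1 x4 x5) + \<rho>B (\<rho>A x4 x5 y2) y3 x1 + \<rho>B y2 (\<rho>A x4 x5 y3) x1)"

definition three_lie_matched_pair ::
  "('f::field \<Rightarrow> 'a::ab_group_add \<Rightarrow> 'a) \<Rightarrow> 'a set \<Rightarrow> ('a \<Rightarrow> 'a \<Rightarrow> 'a \<Rightarrow> 'a)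
    \<Rightarrow> ('f \<Rightarrow> 'b::ab_group_add \<Rightarrow> 'b) \<Rightarrow> 'b set \<Rightarrow> ('b \<Rightarrow> 'b \<Rightarrow> 'b \<Rightarrow> 'b)
    \<Rightarrow> ('a \<Rightarrow> 'a \<Rightarrow> 'b \<Rightarrow> 'b) \<Rightarrow> ('b \<Rightarrow> 'b \<Rightarrow> 'a \<Rightarrow> 'a) \<Rightarrow> bool" where
  "three_lie_matched_pair sA A brA sB B brB \<rho>A \<rho>B \<longleftrightarrow>
     three_lie_rep sA A brA sB B \<rho>A \<and> three_lie_rep sB B brB sA A \<rho>B \<and>
     three_lie_matching A brA B \<rho>A \<rho>B \<and> three_lie_matching B brB A \<rho>B \<rho>A"

text \<open>In the last identity the first summand lies in \<open>B\<close> and the second in \<open>A\<close>; as an identity in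
  the direct sum of \<open>A\<close> and \<open>B\<close> it says that both vanish.\<close>

definition adm_tp3_matched_pair ::
  "('f::field \<Rightarrow> 'a::ab_group_add \<Rightarrow> 'a) \<Rightarrow> 'a set \<Rightarrow> ('a \<Rightarrow> 'a \<Rightarrow> 'a) \<Rightarrow> ('a \<Rightarrow> 'a \<Rightarrow> 'a \<Rightarrow> 'a)
    \<Rightarrow> ('f \<Rightarrow> 'b::ab_group_add \<Rightarrow> 'b) \<Rightarrow> 'b set \<Rightarrow> ('b \<Rightarrow> 'b \<Rightarrow> 'b) \<Rightarrow> ('b \<Rightarrow> 'b \<Rightarrow> 'b \<Rightarrow> 'b)
    \<Rightarrow> ('a \<Rightarrow> 'a \<Rightarrow> 'b \<Rightarrow> 'b) \<Rightarrow> ('a \<Rightarrow> 'b \<Rightarrow> 'b)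
    \<Rightarrow> ('b \<Rightarrow> 'b \<Rightarrow> 'a \<Rightarrow> 'a) \<Rightarrow> ('b \<Rightarrow> 'a \<Rightarrow> 'a) \<Rightarrow> bool" where
  "adm_tp3_matched_pair sA A mA brA sB B mB brB \<rho>A \<mu>A \<rho>B \<mu>B \<longleftrightarrow>
     adm_tp3_algebra sA A mA brA \<and> adm_tp3_algebra sB B mB brB \<and>
     comm_assoc_matched_pair sA A mA sB B mB \<mu>A \<mu>B \<and>
     three_lie_matched_pair sA A brA sB B brB \<rho>A \<rho>B \<and>
     adm_tp3_rep sA A mA brA sB B \<rho>A \<mu>A \<and> adm_tp3_rep sB B mB brB sA A \<rho>B \<mu>B \<and>
     (\<forall>x1\<in>A. \<forall>x2\<in>A. \<forall>x3\<in>A. \<forall>y4\<in>B. \<mu>B y4 (brA x1 x2 x3) = 0) \<and>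
     (\<forall>x1\<in>A. \<forall>x2\<in>A. \<forall>y3\<in>B. \<forall>y4\<in>B. \<rho>A x1 x2 (mB y4 y3) = 0) \<and>
     (\<forall>y1\<in>B. \<forall>y2\<in>B. \<forall>y3\<in>B. \<forall>x4\<in>A. \<mu>A x4 (brB y1 y2 y3) = 0) \<and>
     (\<forall>y1\<in>B. \<forall>y2\<in>B. \<forall>x3\<in>A. \<forall>x4\<in>A. \<rho>B y1 y2 (mA x4 x3) = 0) \<and>
     (\<forall>x2\<in>A. \<forall>x3\<in>A. \<forall>x4\<in>A. \<forall>y1\<in>B. \<mu>B (\<rho>A x2 x3 y1) x4 = 0) \<and>
     (\<forall>y2\<in>B. \<forall>y3\<in>B. \<forall>y4\<in>B. \<forall>x1\<in>A. \<mu>A (\<rho>B y2 y3 x1) y4 = 0) \<and>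
     (\<forall>x2\<in>A. \<forall>x3\<in>A. \<forall>x4\<in>A. \<forall>y1\<in>B. brA (\<mu>B y1 x4) x2 x3 = 0) \<and>
     (\<forall>y2\<in>B. \<forall>y3\<in>B. \<forall>y4\<in>B. \<forall>x1\<in>A. brB (\<mu>A x1 y4) y2 y3 = 0) \<and>
     (\<forall>x1\<in>A. \<forall>x2\<in>A. \<forall>y3\<in>B. \<forall>y4\<in>B.
        \<rho>A (\<mu>B y4 x1) x2 y3 = 0 \<and> \<rho>B y3 (\<mu>A x1 y4) x2 = 0)"


section \<open>Duals\<close>

definition fun_scale :: "'f::field \<Rightarrow> ('x \<Rightarrow> 'f) \<Rightarrow> ('x \<Rightarrow> 'f)" where
  "fun_scale c f = (\<lambda>x. c * f x)"

lemma vector_space_fun_scale: "vector_space fun_scale"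
  by unfold_locales (auto simp: fun_scale_def algebra_simps)

definition dual_space :: "('f::field \<Rightarrow> 'a::ab_group_add \<Rightarrow> 'a) \<Rightarrow> ('a \<Rightarrow> 'f) set" where
  "dual_space s = {\<xi>. Vector_Spaces.linear s (*) \<xi>}"

text \<open>The adjoint maps need no definitions of their own: \<open>ad\<close> is the curried bracket and \<open>L\<close> the
  curried product, so their duals are \<open>dual_rep2 br\<close> and \<open>dual_rep1 m\<close>.\<close>

definition dual_rep1 :: "('x \<Rightarrow> 'w \<Rightarrow> 'w) \<Rightarrow> 'x \<Rightarrow> ('w \<Rightarrow> 'f::field) \<Rightarrow> ('w \<Rightarrow> 'f)" where
  "dual_rep1 \<mu> x \<xi> = (\<lambda>v. - \<xi> (\<mu> x v))"

definition dual_rep2 ::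
  "('x \<Rightarrow> 'x \<Rightarrow> 'w \<Rightarrow> 'w) \<Rightarrow> 'x \<Rightarrow> 'x \<Rightarrow> ('w \<Rightarrow> 'f::field) \<Rightarrow> ('w \<Rightarrow> 'f)" where
  "dual_rep2 \<rho> x y \<xi> = (\<lambda>v. - \<xi> (\<rho> x y v))"

text \<open>The identification of the bidual of a finite-dimensional space with the space itself.\<close>

definition from_bidual ::
  "('f::field \<Rightarrow> 'a::ab_group_add \<Rightarrow> 'a) \<Rightarrow> (('a \<Rightarrow> 'f) \<Rightarrow> 'f) \<Rightarrow> 'a" where
  "from_bidual s \<Phi> = (THE v. \<forall>\<xi>\<in>dual_space s. \<xi> v = \<Phi> \<xi>)"

lemma from_bidual:
  assumes fd: "finite_dimensional_vector_space s Basis"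
    and add: "\<And>\<xi> \<eta>. \<xi> \<in> dual_space s \<Longrightarrow> \<eta> \<in> dual_space s \<Longrightarrow> \<Phi> (\<xi> + \<eta>) = \<Phi> \<xi> + \<Phi> \<eta>"
    and scale: "\<And>c \<xi>. \<xi> \<in> dual_space s \<Longrightarrow> \<Phi> (fun_scale c \<xi>) = c * \<Phi> \<xi>"
    and \<xi>: "\<xi> \<in> dual_space s"
  shows "\<xi> (from_bidual s \<Phi>) = \<Phi> \<xi>"
proof -
  interpret finite_dimensional_vector_space s Basis by (fact fd)
  interpret F: vector_space "(*) :: 'a \<Rightarrow> 'a \<Rightarrow> 'a"
    by unfold_locales (auto simp: algebra_simps)
  interpret P: vector_space_pair s "(*) :: 'a \<Rightarrow> 'a \<Rightarrow> 'a" ..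
  define e where "e b = (\<lambda>x. representation Basis x b)" for b
  have lin: "Vector_Spaces.linear s (*) f \<longleftrightarrow>
      (\<forall>x y. f (x + y) = f x + f y) \<and> (\<forall>c x. f (s c x) = c * f x)" for f :: "'b \<Rightarrow> 'a"
    using vector_space_axioms F.vector_space_axioms by (auto simp: Vector_Spaces.linear_iff)
  have e: "e b \<in> dual_space s" for b
    using independent_Basis span_Basis
    by (auto simp: e_def dual_space_def lin representation_add representation_scale)
  have repr: "(\<Sum>b\<in>Basis. s (e b x) b) = x" for x
    unfolding e_def using finite_Basis independent_Basis span_Basis
    by (intro sum_representation_eq) auto
  have eval: "\<eta> x = (\<Sum>b\<in>Basis. e b x * \<eta> b)" if "\<eta> \<in> dual_space s" for \<eta> x
  proof -
    have "Vector_Spaces.linear s (*) \<eta>" using that by (simp add: dual_space_def)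
    then have "\<eta> (\<Sum>b\<in>Basis. s (e b x) b) = (\<Sum>b\<in>Basis. e b x * \<eta> b)"
      by (simp add: P.linear_sum P.linear_scale)
    then show ?thesis by (simp add: repr)
  qed
  have dual_scale: "fun_scale c \<eta> \<in> dual_space s" if "\<eta> \<in> dual_space s" for c \<eta>
    using that by (simp add: dual_space_def lin fun_scale_def distrib_left mult.left_commute)
  have dual_add: "\<eta> + \<zeta> \<in> dual_space s" if "\<eta> \<in> dual_space s" "\<zeta> \<in> dual_space s" for \<eta> \<zeta>
    using that by (simp add: dual_space_def lin distrib_left ac_simps)
  define v where "v = (\<Sum>b\<in>Basis. s (\<Phi> (e b)) b)"
  have sub: "finite B \<Longrightarrow> (\<Sum>b\<in>B. fun_scale (c b) (e b)) \<in> dual_space s \<and>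
      \<Phi> (\<Sum>b\<in>B. fun_scale (c b) (e b)) = (\<Sum>b\<in>B. c b * \<Phi> (e b))" for B c
  proof (induction B rule: finite_induct)
    case empty
    have z: "(0 :: 'b \<Rightarrow> 'a) \<in> dual_space s" by (simp add: dual_space_def lin)
    have "fun_scale (0::'a) 0 = (0 :: 'b \<Rightarrow> 'a)" by (simp add: fun_scale_def fun_eq_iff)
    with scale[OF z, of 0] have "\<Phi> 0 = 0" by (metis mult_zero_left)
    with z show ?case unfolding sum.empty by blast
  next
    case (insert b B)
    let ?g = "\<lambda>b. fun_scale (c b) (e b)"
    have b: "?g b \<in> dual_space s" by (rule dual_scale[OF e])
    have IH: "sum ?g B \<in> dual_space s" "\<Phi> (sum ?g B) = (\<Sum>b\<in>B. c b * \<Phi> (e b))"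
      using insert.IH by blast+
    have "?g b + sum ?g B \<in> dual_space s" by (rule dual_add[OF b IH(1)])
    moreover have "\<Phi> (?g b + sum ?g B) = c b * \<Phi> (e b) + (\<Sum>b\<in>B. c b * \<Phi> (e b))"
      by (simp only: add[OF b IH(1)] scale[OF e] IH(2))
    ultimately show ?case unfolding sum.insert[OF insert.hyps] by blast
  qed
  have app: "(\<Sum>b\<in>B. g b) x = (\<Sum>b\<in>B. g b x)" if "finite B" for B x and g :: "'b \<Rightarrow> 'b \<Rightarrow> 'a"
    using that by (induction B rule: finite_induct) auto
  have ex: "\<eta> v = \<Phi> \<eta>" if \<eta>: "\<eta> \<in> dual_space s" for \<eta>
  proof -
    have *: "\<eta> = (\<Sum>b\<in>Basis. fun_scale (\<eta> b) (e b))"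
      by (rule ext, subst eval[OF \<eta>]) (simp add: app finite_Basis fun_scale_def mult.commute)
    have "\<Phi> \<eta> = (\<Sum>b\<in>Basis. \<eta> b * \<Phi> (e b))"
      by (rule trans[OF arg_cong[of _ _ \<Phi>, OF *]]) (use sub[OF finite_Basis, of \<eta>] in blast)
    also have "\<dots> = \<eta> v"
    proof -
      have "Vector_Spaces.linear s (*) \<eta>" using \<eta> by (simp add: dual_space_def)
      then show ?thesis by (simp add: v_def P.linear_sum P.linear_scale mult.commute)
    qed
    finally show ?thesis by simp
  qed
  have "from_bidual s \<Phi> = v"
    unfolding from_bidual_def
  proof (rule the_equality)
    fix w assume "\<forall>\<xi>\<in>dual_space s. \<xi> w = \<Phi> \<xi>"
    then have *: "e b w = e b v" for b using ex[OF e] e by metis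
    have "w = (\<Sum>b\<in>Basis. s (e b w) b)" by (rule repr[symmetric])
    also have "\<dots> = v" unfolding * by (rule repr)
    finally show "w = v" .
  qed (use ex in blast)
  then show ?thesis using ex \<xi> by simp
qed

text \<open>Duals of representations on the dual space, transported to the space itself.\<close>

definition codual_rep1 ::
  "('f::field \<Rightarrow> 'a::ab_group_add \<Rightarrow> 'a) \<Rightarrow> ('x \<Rightarrow> ('a \<Rightarrow> 'f) \<Rightarrow> ('a \<Rightarrow> 'f)) \<Rightarrow> 'x \<Rightarrow> 'a \<Rightarrow> 'a" where
  "codual_rep1 s \<mu> \<xi> x = from_bidual s (dual_rep1 \<mu> \<xi> (\<lambda>\<zeta>. \<zeta> x))"

definition codual_rep2 ::
  "('f::field \<Rightarrow> 'a::ab_group_add \<Rightarrow> 'a) \<Rightarrow> ('x \<Rightarrow> 'x \<Rightarrow> ('a \<Rightarrow> 'f) \<Rightarrow> ('a \<Rightarrow> 'f))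
    \<Rightarrow> 'x \<Rightarrow> 'x \<Rightarrow> 'a \<Rightarrow> 'a" where
  "codual_rep2 s \<rho> \<xi> \<eta> x = from_bidual s (dual_rep2 \<rho> \<xi> \<eta> (\<lambda>\<zeta>. \<zeta> x))"


section \<open>Tensor powers\<close>

text \<open>A tensor \<open>t\<close> of order \<open>n\<close> over a space \<open>A\<close> is represented by its pairing with the
  decomposable tensors over the dual space: \<open>t [\<xi>\<^sub>1, \<dots>, \<xi>\<^sub>n]\<close> is the pairing of
  \<open>\<xi>\<^sub>1 \<otimes> \<dots> \<otimes> \<xi>\<^sub>n\<close> with \<open>t\<close>. The function is \<open>0\<close> on all other lists, so that equality of
  tensors is equality of functions. Functionals separate points over a field, so the span of the
  decomposable tensors in this function space is the tensor power. Tensor factors are numbered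
  from \<open>0\<close>.\<close>

type_synonym ('f, 'a) tensor = "('a \<Rightarrow> 'f) list \<Rightarrow> 'f"

definition pure_tensor :: "('f::field \<Rightarrow> 'a::ab_group_add \<Rightarrow> 'a) \<Rightarrow> 'a list \<Rightarrow> ('f, 'a) tensor" where
  "pure_tensor s xs = (\<lambda>\<xi>s. if length \<xi>s = length xs \<and> set \<xi>s \<subseteq> dual_space s
     then \<Prod>i<length xs. (\<xi>s ! i) (xs ! i) else 0)"

definition tensor_power ::
  "('f::field \<Rightarrow> 'a::ab_group_add \<Rightarrow> 'a) \<Rightarrow> nat \<Rightarrow> ('f, 'a) tensor set" where
  "tensor_power s n = module.span fun_scale (pure_tensor s ` {xs. length xs = n})"

text \<open>\<open>factor_map s i \<phi>\<close> is \<open>1 \<otimes> \<dots> \<otimes> \<phi> \<otimes> \<dots> \<otimes> 1\<close> with the endomorphism \<open>\<phi>\<close> in position \<open>i\<close>.\<close>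

definition factor_map ::
  "('f::field \<Rightarrow> 'a::ab_group_add \<Rightarrow> 'a) \<Rightarrow> nat \<Rightarrow> ('a \<Rightarrow> 'a) \<Rightarrow> ('f, 'a) tensor \<Rightarrow> ('f, 'a) tensor" where
  "factor_map s i \<phi> t = (\<lambda>\<xi>s. if set \<xi>s \<subseteq> dual_space s
     then t (\<xi>s[i := \<lambda>x. (\<xi>s ! i) (\<phi> x)]) else 0)"

text \<open>\<open>factor_comult s i k \<phi>\<close> is \<open>1 \<otimes> \<dots> \<otimes> \<phi> \<otimes> \<dots> \<otimes> 1\<close> with a linear map \<open>\<phi>\<close> from the space to
  its \<open>k\<close>-th tensor power in position \<open>i\<close>; it turns tensors of order \<open>n\<close> into tensors of
  order \<open>n - 1 + k\<close>.\<close>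

definition factor_comult ::
  "('f::field \<Rightarrow> 'a::ab_group_add \<Rightarrow> 'a) \<Rightarrow> nat \<Rightarrow> nat \<Rightarrow> ('a \<Rightarrow> ('f, 'a) tensor)
    \<Rightarrow> ('f, 'a) tensor \<Rightarrow> ('f, 'a) tensor" where
  "factor_comult s i k \<phi> t = (\<lambda>\<xi>s. if set \<xi>s \<subseteq> dual_space s
     then t (take i \<xi>s @ [\<lambda>x. \<phi> x (take k (drop i \<xi>s))] @ drop (i + k) \<xi>s) else 0)"

definition swap_factors :: "nat \<Rightarrow> nat \<Rightarrow> ('f, 'a) tensor \<Rightarrow> ('f, 'a) tensor" where
  "swap_factors i j t = (\<lambda>\<xi>s. t (\<xi>s[i := \<xi>s ! j, j := \<xi>s ! i]))"

text \<open>The expected formulas on decomposable tensors.\<close>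

lemma linear_imp_comp_dual:
  assumes "Vector_Spaces.linear s s \<phi>" and "\<xi> \<in> dual_space s"
  shows "(\<lambda>x. \<xi> (\<phi> x)) \<in> dual_space s"
  using Vector_Spaces.linear_compose[of s s \<phi> "(*)" \<xi>] assms by (simp add: dual_space_def o_def)

lemma factor_map_pure_tensor:
  assumes lin: "Vector_Spaces.linear s s \<phi>" and i: "i < length xs"
  shows "factor_map s i \<phi> (pure_tensor s xs) = pure_tensor s (xs[i := \<phi> (xs ! i)])"
proof (rule ext)
  fix \<xi>s :: "('b \<Rightarrow> 'a) list"
  show "factor_map s i \<phi> (pure_tensor s xs) \<xi>s = pure_tensor s (xs[i := \<phi> (xs ! i)]) \<xi>s"
  proof (cases "set \<xi>s \<subseteq> dual_space s \<and> length \<xi>s = length xs")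
    case True
    then have "\<xi>s ! i \<in> dual_space s" using i by auto
    then have "set (\<xi>s[i := \<lambda>x. (\<xi>s ! i) (\<phi> x)]) \<subseteq> dual_space s"
      using True linear_imp_comp_dual[OF lin] set_update_subset_insert by fastforce
    then show ?thesis using True i
      by (auto simp: factor_map_def pure_tensor_def nth_list_update intro!: prod.cong)
  qed (auto simp: factor_map_def pure_tensor_def)
qed

lemma swap_factors_pure_tensor:
  assumes "i < length xs" and "j < length xs"
  shows "swap_factors i j (pure_tensor s xs) = pure_tensor s (xs[i := xs ! j, j := xs ! i])"
proof (rule ext)
  fix \<xi>s
  define p where "p k = (if k = j then i else if k = i then j else k)" for k
  show "swap_factors i j (pure_tensor s xs) \<xi>s = pure_tensor s (xs[i := xs ! j, j := xs ! i]) \<xi>s"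
  proof (cases "length \<xi>s = length xs")
    case True
    have "(\<Prod>k<length xs. (\<xi>s[i := \<xi>s ! j, j := \<xi>s ! i] ! k) (xs ! k))
        = (\<Prod>k<length xs. (\<xi>s ! k) (xs[i := xs ! j, j := xs ! i] ! k))"
      using assms True
      by (intro prod.reindex_bij_witness[of _ p p]) (auto simp: p_def nth_list_update)
    then show ?thesis using True assms by (simp add: swap_factors_def pure_tensor_def)
  qed (simp add: swap_factors_def pure_tensor_def)
qed

lemma factor_comult_pure_tensor:
  assumes lin: "Vector_Spaces.linear s fun_scale \<phi>" and i: "i < length xs"
    and y: "\<phi> (xs ! i) = pure_tensor s ys" "length ys = k"
    and len: "length \<xi>s = length xs - 1 + k"
  shows "factor_comult s i k \<phi> (pure_tensor s xs) \<xi>s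
    = pure_tensor s (take i xs @ ys @ drop (Suc i) xs) \<xi>s"
proof (cases "set \<xi>s \<subseteq> dual_space s")
  case True
  interpret V: Vector_Spaces.linear s fun_scale \<phi> by (fact lin)
  obtain as x bs where xs: "xs = as @ x # bs" "length as = i"
    using id_take_nth_drop[OF i] i by (metis length_take min.absorb4)
  define \<alpha>s \<beta>s \<gamma>s where "\<alpha>s = take i \<xi>s" and "\<beta>s = take k (drop i \<xi>s)" and "\<gamma>s = drop (i + k) \<xi>s"
  have \<xi>s: "\<xi>s = \<alpha>s @ \<beta>s @ \<gamma>s"
    unfolding \<alpha>s_def \<beta>s_def \<gamma>s_def by (metis append_take_drop_id drop_drop add.commute)
  have lens: "length \<alpha>s = length as" "length \<beta>s = length ys" "length \<gamma>s = length bs"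
    using len xs y by (auto simp: \<alpha>s_def \<beta>s_def \<gamma>s_def)
  have d: "(\<lambda>x. \<phi> x \<beta>s) \<in> dual_space s"
    using V.vs1.vector_space_axioms
    by (auto simp: dual_space_def Vector_Spaces.linear_iff V.add V.scale fun_scale_def
        vector_space_def algebra_simps)
  have pure: "pure_tensor s us \<eta>s = prod_list (map2 (\<lambda>\<eta> u. \<eta> u) \<eta>s us)"
    if "length \<eta>s = length us" "set \<eta>s \<subseteq> dual_space s" for us \<eta>s
    using that by (auto simp: pure_tensor_def prod.list_conv_set_nth atLeast0LessThan intro!: prod.cong)
  have sets: "set \<alpha>s \<subseteq> dual_space s" "set \<beta>s \<subseteq> dual_space s" "set \<gamma>s \<subseteq> dual_space s"
    using True \<xi>s by auto
  have "factor_comult s i k \<phi> (pure_tensor s xs) \<xi>s = pure_tensor s xs (\<alpha>s @ [\<lambda>x. \<phi> x \<beta>s] @ \<gamma>s)"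
    using True by (simp add: factor_comult_def \<alpha>s_def \<beta>s_def \<gamma>s_def)
  also have "\<dots> = prod_list (map2 (\<lambda>\<eta> u. \<eta> u) \<alpha>s as) * \<phi> x \<beta>s * prod_list (map2 (\<lambda>\<eta> u. \<eta> u) \<gamma>s bs)"
    using sets d lens by (subst pure) (auto simp: xs mult.assoc)
  also have "\<phi> x \<beta>s = prod_list (map2 (\<lambda>\<eta> u. \<eta> u) \<beta>s ys)"
    using y xs sets lens by (simp add: nth_append pure)
  also have "prod_list (map2 (\<lambda>\<eta> u. \<eta> u) \<alpha>s as) * \<dots> * prod_list (map2 (\<lambda>\<eta> u. \<eta> u) \<gamma>s bs)
      = pure_tensor s (as @ ys @ bs) \<xi>s"
    using sets lens by (subst pure) (auto simp: \<xi>s mult.assoc)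
  moreover have "take i xs = as" "drop (Suc i) xs = bs"
    unfolding xs(1) using xs(2) by auto
  ultimately show ?thesis by (simp only:)
qed (simp add: factor_comult_def pure_tensor_def)


section \<open>Coalgebras\<close>

text \<open>The transposes of maps from the space to its second and third tensor power.\<close>

definition transpose2 ::
  "('a \<Rightarrow> ('f, 'a) tensor) \<Rightarrow> ('a \<Rightarrow> 'f) \<Rightarrow> ('a \<Rightarrow> 'f) \<Rightarrow> ('a \<Rightarrow> 'f)" where
  "transpose2 \<Delta> \<xi> \<eta> = (\<lambda>x. \<Delta> x [\<xi>, \<eta>])"

definition transpose3 ::
  "('a \<Rightarrow> ('f, 'a) tensor) \<Rightarrow> ('a \<Rightarrow> 'f) \<Rightarrow> ('a \<Rightarrow> 'f) \<Rightarrow> ('a \<Rightarrow> 'f) \<Rightarrow> ('a \<Rightarrow> 'f)" where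
  "transpose3 \<delta> \<xi> \<eta> \<zeta> = (\<lambda>x. \<delta> x [\<xi>, \<eta>, \<zeta>])"

definition cocomm_coassoc_coalgebra ::
  "('f::field \<Rightarrow> 'a::ab_group_add \<Rightarrow> 'a) \<Rightarrow> ('a \<Rightarrow> ('f, 'a) tensor) \<Rightarrow> bool" where
  "cocomm_coassoc_coalgebra s \<Delta> \<longleftrightarrow>
     Vector_Spaces.linear s fun_scale \<Delta> \<and> (\<forall>x. \<Delta> x \<in> tensor_power s 2) \<and>
     (\<forall>x. swap_factors 0 1 (\<Delta> x) = \<Delta> x) \<and>
     (\<forall>x. factor_comult s 0 2 \<Delta> (\<Delta> x) = factor_comult s 1 2 \<Delta> (\<Delta> x))"

definition three_lie_coalgebra ::
  "('f::field \<Rightarrow> 'a::ab_group_add \<Rightarrow> 'a) \<Rightarrow> ('a \<Rightarrow> ('f, 'a) tensor) \<Rightarrow> bool" where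
  "three_lie_coalgebra s \<delta> \<longleftrightarrow>
     Vector_Spaces.linear s fun_scale \<delta> \<and> (\<forall>x. \<delta> x \<in> tensor_power s 3) \<and>
     skew3_on (dual_space s) (transpose3 \<delta>) \<and>
     (\<forall>x. factor_comult s 0 3 \<delta> (\<delta> x)
        + swap_factors 1 2 (swap_factors 0 1 (factor_comult s 1 3 \<delta> (\<delta> x)))
        + swap_factors 0 2 (swap_factors 1 3 (factor_comult s 2 3 \<delta> (\<delta> x)))
        = factor_comult s 2 3 \<delta> (\<delta> x))"

definition adm_tp3_coalgebra ::
  "('f::field \<Rightarrow> 'a::ab_group_add \<Rightarrow> 'a) \<Rightarrow> ('a \<Rightarrow> ('f, 'a) tensor) \<Rightarrow> ('a \<Rightarrow> ('f, 'a) tensor)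
    \<Rightarrow> bool" where
  "adm_tp3_coalgebra s \<Delta> \<delta> \<longleftrightarrow>
     cocomm_coassoc_coalgebra s \<Delta> \<and> three_lie_coalgebra s \<delta> \<and>
     (\<forall>x. factor_comult s 0 2 \<Delta> (\<delta> x) = 0 \<and> factor_comult s 1 3 \<delta> (\<Delta> x) = 0)"


section \<open>Bialgebras\<close>

definition comm_cocomm_inf_bialgebra ::
  "('f::field \<Rightarrow> 'a::ab_group_add \<Rightarrow> 'a) \<Rightarrow> ('a \<Rightarrow> 'a \<Rightarrow> 'a) \<Rightarrow> ('a \<Rightarrow> ('f, 'a) tensor)
    \<Rightarrow> bool" where
  "comm_cocomm_inf_bialgebra s m \<Delta> \<longleftrightarrow>
     comm_assoc_algebra s UNIV m \<and> cocomm_coassoc_coalgebra s \<Delta> \<and>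
     (\<forall>x y. \<Delta> (m x y) = factor_map s 0 (m x) (\<Delta> y) + factor_map s 1 (m y) (\<Delta> x))"

definition dc_three_lie_bialgebra ::
  "('f::field \<Rightarrow> 'a::ab_group_add \<Rightarrow> 'a) \<Rightarrow> ('a \<Rightarrow> 'a \<Rightarrow> 'a \<Rightarrow> 'a) \<Rightarrow> ('a \<Rightarrow> ('f, 'a) tensor)
    \<Rightarrow> bool" where
  "dc_three_lie_bialgebra s br \<delta> \<longleftrightarrow>
     three_lie_algebra s UNIV br \<and> three_lie_coalgebra s \<delta> \<and>
     (\<forall>x y z. \<delta> (br x y z) = factor_map s 2 (br y z) (\<delta> x) + factor_map s 2 (br z x) (\<delta> y)
        + factor_map s 2 (br x y) (\<delta> z)) \<and>
     (\<forall>x y z. \<delta> (br x y z) = factor_map s 2 (br y z) (\<delta> x) + factor_map s 1 (br y z) (\<delta> x)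
        + factor_map s 0 (br y z) (\<delta> x))"

definition dc_adm_tp3_bialgebra ::
  "('f::field \<Rightarrow> 'a::ab_group_add \<Rightarrow> 'a) \<Rightarrow> ('a \<Rightarrow> 'a \<Rightarrow> 'a) \<Rightarrow> ('a \<Rightarrow> 'a \<Rightarrow> 'a \<Rightarrow> 'a)
    \<Rightarrow> ('a \<Rightarrow> ('f, 'a) tensor) \<Rightarrow> ('a \<Rightarrow> ('f, 'a) tensor) \<Rightarrow> bool" where
  "dc_adm_tp3_bialgebra s m br \<Delta> \<delta> \<longleftrightarrow>
     adm_tp3_algebra s UNIV m br \<and> adm_tp3_coalgebra s \<Delta> \<delta> \<and>
     dc_three_lie_bialgebra s br \<delta> \<and> comm_cocomm_inf_bialgebra s m \<Delta> \<and>
     (\<forall>x y z. \<Delta> (br x y z) = 0) \<and>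
     (\<forall>x y. \<delta> (m x y) = 0) \<and>
     (\<forall>x y z. factor_map s 0 (br y z) (\<Delta> x) = 0) \<and>
     (\<forall>x y. factor_map s 2 (m y) (\<delta> x) = 0) \<and>
     (\<forall>x y z. factor_map s 1 (br y z) (\<Delta> x) = 0) \<and>
     (\<forall>x y. factor_map s 0 (m y) (\<delta> x) = 0)"

end

theory Submission
  imports Defs
begin

text \<open>Every identity in \<open>A\<close>, \<open>A\<^sup>*\<close> or a tensor power of \<open>A\<close> is tested against functionals,
  respectively vectors, and becomes a scalar identity in the two products on \<open>A\<^sup>*\<close> and the
  transposes of \<open>ad\<close> and \<open>L\<close>. The coadjoint maps are always representations.
  Write (D1), (D2) for the two conditions on \<open>\<delta>([x,y,z])\<close> of a double construction 3-Lie bialgebra.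
  The first matching condition with values in \<open>A\<close> is (D1), the third is (D2), and the second follows
  by subtracting (D2) from (D1), the latter being applied in the second tensor factor; the conditions
  with values in \<open>A\<^sup>*\<close> arise in the same way. Both conditions on the commutative products are the
  infinitesimal bialgebra identity, and each remaining condition is the vanishing of one of four
  scalar expressions.\<close>

subsection \<open>Coadjoint representations over a dual pair\<close>

text \<open>The pairing of a space with its dual is used in both directions: once with
  \<open>V\<close> the original space and \<open>W\<close> its dual, once exchanged. Abstracting it
  lets each fact on coadjoint actions be proved once. The identities of interest lie in
  \<open>W\<close>, so elements of \<open>W\<close> are separated by pairing with
  \<open>V\<close>.\<close>

locale dual_pairing =
  fixes s :: "'f::field_char_0 \<Rightarrow> 'v::ab_group_add \<Rightarrow> 'v" and V :: "'v set"
    and t :: "'f \<Rightarrow> 'w::ab_group_add \<Rightarrow> 'w" and W :: "'w set"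
    and p :: "'v \<Rightarrow> 'w \<Rightarrow> 'f"
  assumes V: "vspace s V" and W: "vspace t W"
    and add_left: "x \<in> V \<Longrightarrow> y \<in> V \<Longrightarrow> w \<in> W \<Longrightarrow> p (x + y) w = p x w + p y w"
    and scale_left: "x \<in> V \<Longrightarrow> w \<in> W \<Longrightarrow> p (s c x) w = c * p x w"
    and add_right: "x \<in> V \<Longrightarrow> w \<in> W \<Longrightarrow> u \<in> W \<Longrightarrow> p x (w + u) = p x w + p x u"
    and scale_right: "x \<in> V \<Longrightarrow> w \<in> W \<Longrightarrow> p x (t c w) = c * p x w"
    and separating: "w \<in> W \<Longrightarrow> u \<in> W \<Longrightarrow> (\<And>x. x \<in> V \<Longrightarrow> p x w = p x u) \<Longrightarrow> w = u"
begin

section \<open>Closure of the carriers and bilinearity of the pairing\<close>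

lemma closed_left:
  shows "0 \<in> V" "x \<in> V \<Longrightarrow> y \<in> V \<Longrightarrow> x + y \<in> V" "x \<in> V \<Longrightarrow> s c x \<in> V"
    "x \<in> V \<Longrightarrow> - x \<in> V" "x \<in> V \<Longrightarrow> y \<in> V \<Longrightarrow> x - y \<in> V"
proof -
  interpret vector_space s using V by (simp add: vspace_def)
  have "subspace V" using V by (simp add: vspace_def)
  then show "0 \<in> V" "x \<in> V \<Longrightarrow> y \<in> V \<Longrightarrow> x + y \<in> V" "x \<in> V \<Longrightarrow> s c x \<in> V"
    "x \<in> V \<Longrightarrow> - x \<in> V" "x \<in> V \<Longrightarrow> y \<in> V \<Longrightarrow> x - y \<in> V"
    by (auto intro: subspace_0 subspace_add subspace_scale subspace_neg subspace_diff)
qed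

lemma closed_right:
  shows "0 \<in> W" "w \<in> W \<Longrightarrow> u \<in> W \<Longrightarrow> w + u \<in> W" "w \<in> W \<Longrightarrow> t c w \<in> W"
    "w \<in> W \<Longrightarrow> - w \<in> W" "w \<in> W \<Longrightarrow> u \<in> W \<Longrightarrow> w - u \<in> W"
proof -
  interpret vector_space t using W by (simp add: vspace_def)
  have "subspace W" using W by (simp add: vspace_def)
  then show "0 \<in> W" "w \<in> W \<Longrightarrow> u \<in> W \<Longrightarrow> w + u \<in> W" "w \<in> W \<Longrightarrow> t c w \<in> W"
    "w \<in> W \<Longrightarrow> - w \<in> W" "w \<in> W \<Longrightarrow> u \<in> W \<Longrightarrow> w - u \<in> W"
    by (auto intro: subspace_0 subspace_add subspace_scale subspace_neg subspace_diff)
qed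

lemma pairing_zero [simp]: "x \<in> V \<Longrightarrow> p x 0 = 0" "w \<in> W \<Longrightarrow> p 0 w = 0"
  using add_right[of x 0 0] add_left[of 0 0 w] closed_left(1) closed_right(1) by auto

lemma minus_right: "x \<in> V \<Longrightarrow> w \<in> W \<Longrightarrow> p x (- w) = - p x w"
  using add_right[of x w "- w"] closed_right(4) by (simp add: eq_neg_iff_add_eq_0 add.commute)

lemma minus_left: "x \<in> V \<Longrightarrow> w \<in> W \<Longrightarrow> p (- x) w = - p x w"
  using add_left[of x "- x" w] closed_left(4) by (simp add: eq_neg_iff_add_eq_0 add.commute)

lemma diff_right: "x \<in> V \<Longrightarrow> w \<in> W \<Longrightarrow> u \<in> W \<Longrightarrow> p x (w - u) = p x w - p x u"
  using add_right[of x w "- u"] closed_right(4) minus_right by simp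

lemma diff_left: "x \<in> V \<Longrightarrow> y \<in> V \<Longrightarrow> w \<in> W \<Longrightarrow> p (x - y) w = p x w - p y w"
  using add_left[of x "- y" w] closed_left(4) minus_left by simp

lemmas pairing_simps =
  add_left scale_left add_right scale_right minus_left minus_right diff_left diff_right closed_left closed_right

text \<open>Transposition reverses composition, which does no harm because multiplication operators
  of a commutative associative algebra commute. \<open>adjoint\<close> has a plus sign because it
  describes the negative of the dual of \<open>L\<close>; the dual itself satisfies the product rule
  only up to sign.\<close>

lemma coadjoint_comm_assoc_rep:
  assumes A: "comm_assoc_algebra s V m"
    and closed: "\<And>x w. x \<in> V \<Longrightarrow> w \<in> W \<Longrightarrow> \<mu> x w \<in> W"
    and adjoint: "\<And>x v w. x \<in> V \<Longrightarrow> v \<in> V \<Longrightarrow> w \<in> W \<Longrightarrow> p v (\<mu> x w) = p (m x v) w"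
  shows "comm_assoc_rep s V m t W \<mu>"
proof -
  have m: "m x y \<in> V" "m (s c x) y = s c (m x y)" "m x (s c y) = s c (m x y)" "m y x = m x y"
    if "x \<in> V" "y \<in> V" for x y c
    using A that by (auto simp: comm_assoc_algebra_def linear_on_def)
  have m': "m (x + z) y = m x y + m z y" "m x (y + z) = m x y + m x z"
    "m (m x y) z = m x (m y z)"
    if "x \<in> V" "y \<in> V" "z \<in> V" for x y z
    using A that by (auto simp: comm_assoc_algebra_def linear_on_def)
  have comp: "m (m x y) v = m y (m x v)" if "x \<in> V" "y \<in> V" "v \<in> V" for x y v
    using that m(4)[of x y] m'(3)[of y x v] by simp
  have "\<mu> (m x y) w = \<mu> x (\<mu> y w)" if "x \<in> V" "y \<in> V" "w \<in> W" for x y w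
    using that by (intro separating) (simp_all add: closed m(1) adjoint comp)
  moreover have "linear_on t W t W (\<mu> x)" if "x \<in> V" for x
    unfolding linear_on_def using that
    by (auto simp: closed m closed_left closed_right intro!: separating)
      (simp_all add: adjoint closed pairing_simps m m')
  moreover have "linear_on s V t W (\<lambda>x. \<mu> x w)" if "w \<in> W" for w
    unfolding linear_on_def using that
    by (auto simp: closed m closed_left closed_right intro!: separating)
      (simp_all add: adjoint closed pairing_simps m m')
  ultimately show ?thesis using A W by (auto simp: comm_assoc_rep_def)
qed

text \<open>Dualising reverses the order of composition, so the second representation identity is not
  the fundamental identity itself: it is obtained from it only after division by \<open>3\<close>.\<close>

lemma coadjoint_three_lie_rep:
  assumes A: "three_lie_algebra s V br"
    and closed: "\<And>x y w. x \<in> V \<Longrightarrow> y \<in> V \<Longrightarrow> w \<in> W \<Longrightarrow> \<rho> x y w \<in> W"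
    and adjoint: "\<And>x y v w. x \<in> V \<Longrightarrow> y \<in> V \<Longrightarrow> v \<in> V \<Longrightarrow> w \<in> W \<Longrightarrow> p v (\<rho> x y w) = - p (br x y v) w"
  shows "three_lie_rep s V br t W \<rho>"
proof -
  have br: "br x y z \<in> V" "br (s c x) y z = s c (br x y z)" "br x (s c y) z = s c (br x y z)"
    "br x y (s c z) = s c (br x y z)"
    if "x \<in> V" "y \<in> V" "z \<in> V" for x y z c
    using A that by (auto simp: three_lie_algebra_def trilinear_on_def linear_on_def)
  have br': "br (x + u) y z = br x y z + br u y z" "br x (y + u) z = br x y z + br x u z"
    "br x y (z + u) = br x y z + br x y u"
    if "x \<in> V" "y \<in> V" "z \<in> V" "u \<in> V" for x y z u
    using A that by (auto simp: three_lie_algebra_def trilinear_on_def linear_on_def)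
  have skew: "br y x z = - br x y z" "br x z y = - br x y z"
    if "x \<in> V" "y \<in> V" "z \<in> V" for x y z
    using A that unfolding three_lie_algebra_def skew3_on_def by blast+
  have FI: "br a b (br c d e) = br (br a b c) d e + br c (br a b d) e + br c d (br a b e)"
    if "a \<in> V" "b \<in> V" "c \<in> V" "d \<in> V" "e \<in> V" for a b c d e
    using A that unfolding three_lie_algebra_def by blast
  have lin1: "linear_on t W t W (\<rho> x y)" if "x \<in> V" "y \<in> V" for x y
    unfolding linear_on_def using that
    by (auto simp: closed br closed_left closed_right intro!: separating)
      (simp_all add: adjoint closed pairing_simps br br')
  have lin2: "linear_on s V t W (\<lambda>x. \<rho> x y w)" if "y \<in> V" "w \<in> W" for y w
    unfolding linear_on_def using that
    by (auto simp: closed br closed_left closed_right intro!: separating)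
      (simp_all add: adjoint closed pairing_simps br br')
  have lin3: "linear_on s V t W (\<lambda>y. \<rho> x y w)" if "x \<in> V" "w \<in> W" for x w
    unfolding linear_on_def using that
    by (auto simp: closed br closed_left closed_right intro!: separating)
      (simp_all add: adjoint closed pairing_simps br br')
  have skew_\<rho>: "\<rho> y x w = - \<rho> x y w" if "x \<in> V" "y \<in> V" "w \<in> W" for x y w
    using that
    by (auto simp: closed closed_right intro!: separating)
      (metis adjoint br(1) minus_left minus_right closed skew(1))
  \<comment> \<open>The fundamental identity read as a commutator relation for ad. Transposing
    reverses the commutator, and the sign of the dual absorbs this, so the relation survives as the
    first representation identity.\<close>
  have comm: "br x1 x2 (br x3 x4 z) - br x3 x4 (br x1 x2 z)
      = br (br x1 x2 x3) x4 z - br (br x1 x2 x4) x3 z"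
    if "x1 \<in> V" "x2 \<in> V" "x3 \<in> V" "x4 \<in> V" "z \<in> V" for x1 x2 x3 x4 z
    using FI[of x1 x2 x3 x4 z] skew(1)[of x3 "br x1 x2 x4" z] that by (simp add: br)
  have rep1: "\<rho> x1 x2 (\<rho> x3 x4 w) - \<rho> x3 x4 (\<rho> x1 x2 w)
      = \<rho> (br x1 x2 x3) x4 w - \<rho> (br x1 x2 x4) x3 w"
    if "x1 \<in> V" "x2 \<in> V" "x3 \<in> V" "x4 \<in> V" "w \<in> W" for x1 x2 x3 x4 w
  proof (rule separating)
    fix z assume z: "z \<in> V"
    show "p z (\<rho> x1 x2 (\<rho> x3 x4 w) - \<rho> x3 x4 (\<rho> x1 x2 w))
      = p z (\<rho> (br x1 x2 x3) x4 w - \<rho> (br x1 x2 x4) x3 w)"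
      using arg_cong[OF comm[OF that(1-4) z], of "\<lambda>v. p v w"] that z
      by (simp add: br closed adjoint diff_left diff_right) (simp add: algebra_simps)
  qed (use that in \<open>auto simp: br closed closed_right\<close>)
  have rep2: "\<rho> (br x1 x2 x3) x4 w = \<rho> x1 x2 (\<rho> x3 x4 w) + \<rho> x2 x3 (\<rho> x1 x4 w)
      + \<rho> x3 x1 (\<rho> x2 x4 w)"
    if "x1 \<in> V" "x2 \<in> V" "x3 \<in> V" "x4 \<in> V" "w \<in> W" for x1 x2 x3 x4 w
  proof (rule separating)
    fix z assume "z \<in> V"
    note x = that(1-4) this
    have cyclic: "br b c a = br a b c" if "a \<in> V" "b \<in> V" "c \<in> V" for a b c
      using skew that by (metis br(1))
    \<comment> \<open>Expanding \<open>br d z (br a b c)\<close> by the fundamental identity gives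
      the second representation identity for ad itself. The dual needs the compositions in the
      opposite order.\<close>
    have adj: "br (br a b c) d z = br a b (br c d z) + br b c (br a d z) + br c a (br b d z)"
      if "a \<in> V" "b \<in> V" "c \<in> V" "d \<in> V" for a b c d
    proof -
      have "br (br a b c) d z = br d z (br a b c)"
        using that \<open>z \<in> V\<close> by (simp add: br cyclic[of "br a b c" d z])
      also have "\<dots> = br (br d z a) b c + br a (br d z b) c + br a b (br d z c)"
        using that \<open>z \<in> V\<close> by (intro FI)
      finally show ?thesis
        using that \<open>z \<in> V\<close> cyclic[of "br a d z" b c]
        by (simp add: br cyclic[of a d z] cyclic[of b d z] cyclic[of c d z] cyclic[of c a "br b d z"])
    qed
    \<comment> \<open>With \<open>w\<close> fixed the pairing is a linear functional, and what
      remains is linear arithmetic among scalars.\<close>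
    define q where "q v = p v w" for v
    have q: "q (u + v) = q u + q v" "q (u - v) = q u - q v" "q (- u) = - q u"
      if "u \<in> V" "v \<in> V" for u v
      using that \<open>w \<in> W\<close> by (simp_all add: q_def pairing_simps)
    \<comment> \<open>The commutator relation for the three cyclic permutations of
      \<open>x1\<close>, \<open>x2\<close>, \<open>x3\<close>; all three share the term with
      \<open>br x1 x2 x3\<close>.\<close>
    have c: "q (br x1 x2 (br x3 x4 z)) - q (br x3 x4 (br x1 x2 z))
        = q (br (br x1 x2 x3) x4 z) - q (br (br x1 x2 x4) x3 z)"
      "q (br x2 x3 (br x1 x4 z)) - q (br x1 x4 (br x2 x3 z))
        = q (br (br x1 x2 x3) x4 z) - q (br (br x2 x3 x4) x1 z)"
      "q (br x3 x1 (br x2 x4 z)) - q (br x2 x4 (br x3 x1 z))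
        = q (br (br x1 x2 x3) x4 z) - q (br (br x3 x1 x4) x2 z)"
      using x comm[of x1 x2 x3 x4 z] comm[of x2 x3 x1 x4 z] comm[of x3 x1 x2 x4 z]
        cyclic[of x1 x2 x3] cyclic[of x3 x1 x2]
      by (simp_all add: br q(2)[symmetric])
    have zero: "br a b 0 = 0" if "a \<in> V" "b \<in> V" for a b
      using br'(3)[of a b 0 0] that closed_left(1) by simp
    have neg: "br a b (- v) = - br a b v" if "a \<in> V" "b \<in> V" "v \<in> V" for a b v
      using br'(3)[of a b v "- v"] that by (simp add: closed_left zero eq_neg_iff_add_eq_0 add.commute)
    have flip: "br a b (br d c z) = - br a b (br c d z)"
      if "a \<in> V" "b \<in> V" "c \<in> V" "d \<in> V" for a b c d
      using that \<open>z \<in> V\<close> by (simp add: skew(1)[of c d z] neg br)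
    have a: "q (br (br x1 x2 x3) x4 z) = q (br x1 x2 (br x3 x4 z)) + q (br x2 x3 (br x1 x4 z))
        + q (br x3 x1 (br x2 x4 z))"
      "q (br (br x1 x2 x4) x3 z) = - q (br x1 x2 (br x3 x4 z)) - q (br x2 x4 (br x3 x1 z))
        - q (br x1 x4 (br x2 x3 z))"
      "q (br (br x2 x3 x4) x1 z) = - q (br x2 x3 (br x1 x4 z)) - q (br x3 x4 (br x1 x2 z))
        - q (br x2 x4 (br x3 x1 z))"
      "q (br (br x3 x1 x4) x2 z) = - q (br x3 x1 (br x2 x4 z)) - q (br x1 x4 (br x2 x3 z))
        - q (br x3 x4 (br x1 x2 z))"
      using x
      by (simp_all add: adj br q closed_left flip[of x1 x2 x3 x4] flip[of x2 x4 x3 x1]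
        flip[of x2 x3 x1 x4] flip[of x3 x4 x1 x2] flip[of x3 x1 x2 x4] flip[of x1 x4 x2 x3]
        skew(1)[of x1 x4 "br x2 x3 z"] skew(1)[of x2 x4 "br x3 x1 z"] skew(1)[of x3 x4 "br x1 x2 z"])
    \<comment> \<open>Sum of the three relations in \<open>c\<close>. The last three lines of
      \<open>a\<close> eliminate \<open>q (br (br x1 x2 x4) x3 z)\<close> and its cyclic companions,
      the compositions with \<open>x4\<close> in the inner bracket cancel, and three times the
      wanted identity remains. Characteristic zero permits the division.\<close>
    have "3 * (q (br (br x1 x2 x3) x4 z) + (q (br x3 x4 (br x1 x2 z)) + q (br x1 x4 (br x2 x3 z))
        + q (br x2 x4 (br x3 x1 z)))) = 0"
      using a c by algebra
    then have "q (br (br x1 x2 x3) x4 z) = - (q (br x3 x4 (br x1 x2 z)) + q (br x1 x4 (br x2 x3 z))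
        + q (br x2 x4 (br x3 x1 z)))"
      unfolding eq_neg_iff_add_eq_0 by (simp del: distrib_left_numeral)
    then show "p z (\<rho> (br x1 x2 x3) x4 w) = p z (\<rho> x1 x2 (\<rho> x3 x4 w) + \<rho> x2 x3 (\<rho> x1 x4 w)
      + \<rho> x3 x1 (\<rho> x2 x4 w))"
      using x \<open>w \<in> W\<close> unfolding q_def
      by (simp add: br closed adjoint add_right closed_right)
  qed (use that in \<open>auto simp: br closed closed_right\<close>)
  show ?thesis
    unfolding three_lie_rep_def
    by (intro conjI ballI A W lin1 lin2 lin3 skew_\<rho> rep1 rep2)
qed

text \<open>The four mixed conditions transpose to the vanishing of \<open>m u (br x y z)\<close> or
  \<open>br (m u x) y z\<close>, up to commutativity and skew-symmetry, and these are axioms of the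
  algebra.\<close>

lemma coadjoint_adm_tp3_rep:
  assumes A: "adm_tp3_algebra s V m br"
    and closed: "\<And>x w. x \<in> V \<Longrightarrow> w \<in> W \<Longrightarrow> \<mu> x w \<in> W"
      "\<And>x y w. x \<in> V \<Longrightarrow> y \<in> V \<Longrightarrow> w \<in> W \<Longrightarrow> \<rho> x y w \<in> W"
    and adjoint: "\<And>x v w. x \<in> V \<Longrightarrow> v \<in> V \<Longrightarrow> w \<in> W \<Longrightarrow> p v (\<mu> x w) = p (m x v) w"
      "\<And>x y v w. x \<in> V \<Longrightarrow> y \<in> V \<Longrightarrow> v \<in> V \<Longrightarrow> w \<in> W \<Longrightarrow> p v (\<rho> x y w) = - p (br x y v) w"
  shows "adm_tp3_rep s V m br t W \<rho> \<mu>"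
proof -
  have m: "m x y \<in> V" "m y x = m x y" if "x \<in> V" "y \<in> V" for x y
    using A that by (auto simp: adm_tp3_algebra_def comm_assoc_algebra_def linear_on_def)
  have br: "br x y z \<in> V" if "x \<in> V" "y \<in> V" "z \<in> V" for x y z
    using A that
    by (auto simp: adm_tp3_algebra_def three_lie_algebra_def trilinear_on_def linear_on_def)
  have skew: "br y x z = - br x y z" "br x z y = - br x y z"
    if "x \<in> V" "y \<in> V" "z \<in> V" for x y z
    using A that unfolding adm_tp3_algebra_def three_lie_algebra_def skew3_on_def by blast+
  have ann: "m u (br x y z) = 0" "br (m u x) y z = 0"
    if "u \<in> V" "x \<in> V" "y \<in> V" "z \<in> V" for u x y z
    using A that by (auto simp: adm_tp3_algebra_def)
  have ann': "m (br x y z) u = 0" "br y z (m u x) = 0"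
    if "u \<in> V" "x \<in> V" "y \<in> V" "z \<in> V" for u x y z
    using that ann m(2)[of u "br x y z"] skew(1)[of y "m u x" z] skew(2)[of y z "m u x"]
    by (simp_all add: br m(1))
  have "\<mu> x (\<rho> y z w) = 0 \<and> \<rho> y z (\<mu> x w) = 0 \<and> \<rho> (m x y) z w = 0 \<and> \<mu> (br x y z) w = 0"
    if "x \<in> V" "y \<in> V" "z \<in> V" "w \<in> W" for x y z w
    using that
    by (auto intro!: separating simp: closed closed_right m(1) br) (simp_all add: adjoint closed m(1) br ann ann')
  moreover have "comm_assoc_rep s V m t W \<mu>"
    using A by (intro coadjoint_comm_assoc_rep closed adjoint) (auto simp: adm_tp3_algebra_def)
  moreover have "three_lie_rep s V br t W \<rho>"
    using A by (intro coadjoint_three_lie_rep closed adjoint) (auto simp: adm_tp3_algebra_def)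
  ultimately show ?thesis using A by (simp add: adm_tp3_rep_def)
qed

end

subsection \<open>The dual algebra of the coalgebra\<close>

lemma fun_scale_apply: "fun_scale c f x = c * f x"
  by (simp add: fun_scale_def)

text \<open>Decomposable tensors have this support, and functions with this support form a subspace.
  Tensors can therefore be compared on lists of \<open>n\<close> functionals alone.\<close>

lemma tensor_power_eq_0:
  assumes "t \<in> tensor_power s n" and "\<not> (length \<xi>s = n \<and> set \<xi>s \<subseteq> dual_space s)"
  shows "t \<xi>s = 0"
proof -
  interpret vector_space fun_scale by (rule vector_space_fun_scale)
  show ?thesis
    using assms(1) unfolding tensor_power_def
  proof (rule span_induct)
    fix t assume "t \<in> pure_tensor s ` {xs. length xs = n}"
    then show "t \<xi>s = 0" using assms(2) unfolding pure_tensor_def by (elim imageE) (simp only: mem_Collect_eq if_False)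
  qed (simp add: subspace_def fun_scale_apply)
qed

text \<open>On a decomposable tensor the factor at position \<open>i\<close> splits off the product,
  and both equations are preserved by linear combinations. This is the source of the multilinearity
  of the transposes.\<close>

lemma tensor_power_multilinear:
  assumes t: "t \<in> tensor_power s n" and i: "i < n" "length \<xi>s = n" "set \<xi>s \<subseteq> dual_space s"
    and D: "\<xi> \<in> dual_space s" "\<eta> \<in> dual_space s" "\<xi> + \<eta> \<in> dual_space s"
      "fun_scale c \<xi> \<in> dual_space s"
  shows "t (\<xi>s[i := \<xi> + \<eta>]) = t (\<xi>s[i := \<xi>]) + t (\<xi>s[i := \<eta>])"
    and "t (\<xi>s[i := fun_scale c \<xi>]) = c * t (\<xi>s[i := \<xi>])"
proof -
  interpret vector_space fun_scale by (rule vector_space_fun_scale)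
  have pure: "pure_tensor s xs (\<xi>s[i := \<zeta>]) = \<zeta> (xs ! i) * (\<Prod>j\<in>{..<n} - {i}. (\<xi>s ! j) (xs ! j))"
    if "\<zeta> \<in> dual_space s" "length xs = n" for xs \<zeta>
  proof -
    have "set (\<xi>s[i := \<zeta>]) \<subseteq> dual_space s"
      using that i set_update_subset_insert by fastforce
    then have "pure_tensor s xs (\<xi>s[i := \<zeta>]) = (\<Prod>j<n. (\<xi>s[i := \<zeta>] ! j) (xs ! j))"
      using i that by (simp add: pure_tensor_def)
    also have "\<dots> = \<zeta> (xs ! i) * (\<Prod>j\<in>{..<n} - {i}. (\<xi>s[i := \<zeta>] ! j) (xs ! j))"
      using i by (subst prod.remove[of _ i]) auto
    finally show ?thesis by simp
  qed
  have "t (\<xi>s[i := \<xi> + \<eta>]) = t (\<xi>s[i := \<xi>]) + t (\<xi>s[i := \<eta>])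
      \<and> t (\<xi>s[i := fun_scale c \<xi>]) = c * t (\<xi>s[i := \<xi>])"
    using t unfolding tensor_power_def
  proof (rule span_induct)
    fix t assume "t \<in> pure_tensor s ` {xs. length xs = n}"
    then show "t (\<xi>s[i := \<xi> + \<eta>]) = t (\<xi>s[i := \<xi>]) + t (\<xi>s[i := \<eta>])
      \<and> t (\<xi>s[i := fun_scale c \<xi>]) = c * t (\<xi>s[i := \<xi>])"
      using D by (auto simp: pure fun_scale_apply distrib_right mult.assoc)
  qed (simp add: subspace_def fun_scale_apply algebra_simps)
  then show "t (\<xi>s[i := \<xi> + \<eta>]) = t (\<xi>s[i := \<xi>]) + t (\<xi>s[i := \<eta>])"
    "t (\<xi>s[i := fun_scale c \<xi>]) = c * t (\<xi>s[i := \<xi>])" by blast+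
qed

section \<open>Functionals on the algebra and transposes of its operators\<close>

locale adm_tp3_algebra_coalgebra =
  fixes s :: "'f::field_char_0 \<Rightarrow> 'a::ab_group_add \<Rightarrow> 'a"
    and Basis :: "'a set"
    and m :: "'a \<Rightarrow> 'a \<Rightarrow> 'a"
    and br :: "'a \<Rightarrow> 'a \<Rightarrow> 'a \<Rightarrow> 'a"
    and \<Delta> \<delta> :: "'a \<Rightarrow> ('f, 'a) tensor"
  assumes fd: "finite_dimensional_vector_space s Basis"
    and alg: "adm_tp3_algebra s UNIV m br"
    and coalg: "adm_tp3_coalgebra s \<Delta> \<delta>"
begin

abbreviation "D \<equiv> dual_space s"
abbreviation "dm \<equiv> transpose2 \<Delta>"
abbreviation "dbr \<equiv> transpose3 \<delta>"

text \<open>Unlike the dual representations, \<open>ad_transpose\<close> and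
  \<open>mult_transpose\<close> carry no sign. They are what a factor map by ad or L does to a
  functional, and they fit directly into a slot of \<open>dm\<close> or \<open>dbr\<close>.\<close>

definition ad_transpose :: "('a \<Rightarrow> 'f) \<Rightarrow> 'a \<Rightarrow> 'a \<Rightarrow> 'a \<Rightarrow> 'f" where
  "ad_transpose \<xi> x y = (\<lambda>v. \<xi> (br x y v))"

definition mult_transpose :: "('a \<Rightarrow> 'f) \<Rightarrow> 'a \<Rightarrow> 'a \<Rightarrow> 'f" where
  "mult_transpose \<xi> x = (\<lambda>v. \<xi> (m x v))"

sublocale finite_dimensional_vector_space s Basis by (fact fd)

lemma m: "m (x + y) z = m x z + m y z" "m z (x + y) = m z x + m z y"
  "m (s c x) y = s c (m x y)" "m x (s c y) = s c (m x y)"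
  and m_commute: "m x y = m y x"
  using alg by (auto simp: adm_tp3_algebra_def comm_assoc_algebra_def linear_on_def)

lemma br: "br (x + u) y z = br x y z + br u y z" "br (s c x) y z = s c (br x y z)"
  "br x (y + u) z = br x y z + br x u z" "br x (s c y) z = s c (br x y z)"
  "br x y (z + u) = br x y z + br x y u" "br x y (s c z) = s c (br x y z)"
  using alg
  by (auto simp: adm_tp3_algebra_def three_lie_algebra_def trilinear_on_def linear_on_def)

lemma br_skew: "br y x z = - br x y z" "br x z y = - br x y z"
  using alg unfolding adm_tp3_algebra_def three_lie_algebra_def skew3_on_def by blast+

lemma br_cyclic: "br x y z = br y z x"
  using br_skew(1)[of x y z] br_skew(2)[of y x z] by simp

lemma dual_iff: "\<xi> \<in> D \<longleftrightarrow> (\<forall>x y. \<xi> (x + y) = \<xi> x + \<xi> y) \<and> (\<forall>c x. \<xi> (s c x) = c * \<xi> x)"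
proof -
  have "vector_space ((*) :: 'f \<Rightarrow> 'f \<Rightarrow> 'f)" by unfold_locales (auto simp: algebra_simps)
  then show ?thesis using vector_space_axioms by (auto simp: dual_space_def Vector_Spaces.linear_iff)
qed

lemma dual:
  assumes "\<xi> \<in> D"
  shows "\<xi> (x + y) = \<xi> x + \<xi> y" "\<xi> (s c x) = c * \<xi> x" "\<xi> 0 = 0" "\<xi> (- x) = - \<xi> x"
    "\<xi> (x - y) = \<xi> x - \<xi> y"
proof -
  show add: "\<xi> (x + y) = \<xi> x + \<xi> y" for x y using assms by (simp add: dual_iff)
  show "\<xi> (s c x) = c * \<xi> x" using assms by (simp add: dual_iff)
  show z: "\<xi> 0 = 0" using add[of 0 0] by simp
  show "\<xi> (- x) = - \<xi> x" for x using add[of x "- x"] z by (simp add: eq_neg_iff_add_eq_0 add.commute)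
  then show "\<xi> (x - y) = \<xi> x - \<xi> y" using add[of x "- y"] by simp
qed

lemma dual_closed:
  "0 \<in> D" "\<xi> \<in> D \<Longrightarrow> \<eta> \<in> D \<Longrightarrow> \<xi> + \<eta> \<in> D" "\<xi> \<in> D \<Longrightarrow> fun_scale c \<xi> \<in> D" "\<xi> \<in> D \<Longrightarrow> - \<xi> \<in> D"
  by (auto simp: dual_iff fun_scale_def algebra_simps)

lemma transpose_closed:
  "\<xi> \<in> D \<Longrightarrow> ad_transpose \<xi> x y \<in> D" "\<xi> \<in> D \<Longrightarrow> mult_transpose \<xi> x \<in> D"
  by (auto simp: dual_iff ad_transpose_def mult_transpose_def br m)

lemma ad_transpose_skew: "\<xi> \<in> D \<Longrightarrow> ad_transpose \<xi> y x = - ad_transpose \<xi> x y"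
  by (auto simp: ad_transpose_def br_skew(1)[of y x] dual)

text \<open>The coordinates with respect to \<open>Basis\<close> are functionals, and they determine
  a vector.\<close>

lemma separating: "x = y" if "\<And>\<xi>. \<xi> \<in> D \<Longrightarrow> \<xi> x = \<xi> y"
proof -
  have "(\<lambda>x. representation Basis x b) \<in> D" for b :: 'a
    using independent_Basis span_Basis
    by (auto simp: dual_iff representation_add representation_scale)
  then have r: "representation Basis x b = representation Basis y b" for b
    using that[of "\<lambda>x. representation Basis x b"] by simp
  have sum: "(\<Sum>b\<in>Basis. s (representation Basis z b) b) = z" for z
    using finite_Basis independent_Basis span_Basis by (intro sum_representation_eq) auto
  have "x = (\<Sum>b\<in>Basis. s (representation Basis x b) b)" by (rule sum[symmetric])
  also have "\<dots> = y" unfolding r by (rule sum)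
  finally show ?thesis .
qed

lemma eq_iff_dual: "x = y \<longleftrightarrow> (\<forall>\<xi>\<in>D. \<xi> x = \<xi> y)"
  using separating by blast

lemma linear_coalgebra:
  "\<Delta> (x + y) = \<Delta> x + \<Delta> y" "\<Delta> (s c x) = fun_scale c (\<Delta> x)"
  "\<delta> (x + y) = \<delta> x + \<delta> y" "\<delta> (s c x) = fun_scale c (\<delta> x)"
  using coalg
  by (auto simp: adm_tp3_coalgebra_def cocomm_coassoc_coalgebra_def three_lie_coalgebra_def
      Vector_Spaces.linear_iff)

lemma tensor_coalgebra: "\<Delta> x \<in> tensor_power s 2" "\<delta> x \<in> tensor_power s 3"
  using coalg
  by (auto simp: adm_tp3_coalgebra_def cocomm_coassoc_coalgebra_def three_lie_coalgebra_def)

section \<open>Multilinearity and symmetry of the operations on the dual space\<close>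

lemma dm_closed: "dm \<xi> \<eta> \<in> D" and dbr_closed: "dbr \<xi> \<eta> \<zeta> \<in> D"
  by (simp_all add: dual_iff transpose2_def transpose3_def linear_coalgebra fun_scale_def)

lemma dm:
  assumes "\<xi> \<in> D" "\<xi>' \<in> D" "\<eta> \<in> D"
  shows "dm (\<xi> + \<xi>') \<eta> = dm \<xi> \<eta> + dm \<xi>' \<eta>" "dm \<eta> (\<xi> + \<xi>') = dm \<eta> \<xi> + dm \<eta> \<xi>'"
    "dm (fun_scale c \<xi>) \<eta> = fun_scale c (dm \<xi> \<eta>)" "dm \<eta> (fun_scale c \<xi>) = fun_scale c (dm \<eta> \<xi>)"
proof -
  note D = assms(1,2) dual_closed(2)[OF assms(1,2)] dual_closed(3)[OF assms(1), of c]
  note T = tensor_power_multilinear[OF tensor_coalgebra(1) _ _ _ D]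
  show "dm (\<xi> + \<xi>') \<eta> = dm \<xi> \<eta> + dm \<xi>' \<eta>" "dm \<eta> (\<xi> + \<xi>') = dm \<eta> \<xi> + dm \<eta> \<xi>'"
    "dm (fun_scale c \<xi>) \<eta> = fun_scale c (dm \<xi> \<eta>)" "dm \<eta> (fun_scale c \<xi>) = fun_scale c (dm \<eta> \<xi>)"
    \<comment> \<open>The list supplies the slot that stays fixed; its entry at the updated position
      is a placeholder.\<close>
    using T[of 0 "[\<eta>, \<eta>]"] T[of 1 "[\<eta>, \<eta>]"] assms
    by (auto simp: transpose2_def fun_eq_iff fun_scale_def)
qed

lemma dbr:
  assumes "\<xi> \<in> D" "\<xi>' \<in> D" "\<eta> \<in> D" "\<zeta> \<in> D"
  shows "dbr (\<xi> + \<xi>') \<eta> \<zeta> = dbr \<xi> \<eta> \<zeta> + dbr \<xi>' \<eta> \<zeta>"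
    "dbr \<eta> (\<xi> + \<xi>') \<zeta> = dbr \<eta> \<xi> \<zeta> + dbr \<eta> \<xi>' \<zeta>"
    "dbr \<eta> \<zeta> (\<xi> + \<xi>') = dbr \<eta> \<zeta> \<xi> + dbr \<eta> \<zeta> \<xi>'"
    "dbr (fun_scale c \<xi>) \<eta> \<zeta> = fun_scale c (dbr \<xi> \<eta> \<zeta>)"
    "dbr \<eta> (fun_scale c \<xi>) \<zeta> = fun_scale c (dbr \<eta> \<xi> \<zeta>)"
    "dbr \<eta> \<zeta> (fun_scale c \<xi>) = fun_scale c (dbr \<eta> \<zeta> \<xi>)"
proof -
  note D = assms(1,2) dual_closed(2)[OF assms(1,2)] dual_closed(3)[OF assms(1), of c]
  note T = tensor_power_multilinear[OF tensor_coalgebra(2) _ _ _ D]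
  show "dbr (\<xi> + \<xi>') \<eta> \<zeta> = dbr \<xi> \<eta> \<zeta> + dbr \<xi>' \<eta> \<zeta>"
    "dbr \<eta> (\<xi> + \<xi>') \<zeta> = dbr \<eta> \<xi> \<zeta> + dbr \<eta> \<xi>' \<zeta>"
    "dbr \<eta> \<zeta> (\<xi> + \<xi>') = dbr \<eta> \<zeta> \<xi> + dbr \<eta> \<zeta> \<xi>'"
    "dbr (fun_scale c \<xi>) \<eta> \<zeta> = fun_scale c (dbr \<xi> \<eta> \<zeta>)"
    "dbr \<eta> (fun_scale c \<xi>) \<zeta> = fun_scale c (dbr \<eta> \<xi> \<zeta>)"
    "dbr \<eta> \<zeta> (fun_scale c \<xi>) = fun_scale c (dbr \<eta> \<zeta> \<xi>)"
    using T[of 0 "[\<eta>, \<eta>, \<zeta>]"] T[of 1 "[\<eta>, \<eta>, \<zeta>]"] T[of 2 "[\<eta>, \<zeta>, \<zeta>]"] assms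
    by (auto simp: transpose3_def fun_eq_iff fun_scale_def)
qed

lemma fun_scale_minus_1: "fun_scale (- 1) \<xi> = - \<xi>" for \<xi> :: "'b \<Rightarrow> 'f"
  by (simp add: fun_scale_def fun_eq_iff)

lemma dbr_minus:
  assumes "\<xi> \<in> D" "\<eta> \<in> D" "\<zeta> \<in> D"
  shows "dbr (- \<xi>) \<eta> \<zeta> = - dbr \<xi> \<eta> \<zeta>" "dbr \<eta> (- \<xi>) \<zeta> = - dbr \<eta> \<xi> \<zeta>"
    "dbr \<eta> \<zeta> (- \<xi>) = - dbr \<eta> \<zeta> \<xi>"
  using dbr(4-6)[OF assms(1,1,2,3), of "- 1"] by (simp_all add: fun_scale_minus_1)

lemma dm_minus:
  assumes "\<xi> \<in> D" "\<eta> \<in> D"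
  shows "dm (- \<xi>) \<eta> = - dm \<xi> \<eta>" "dm \<eta> (- \<xi>) = - dm \<eta> \<xi>"
  using dm(3-4)[OF assms(1,1,2), of "- 1"] by (simp_all add: fun_scale_minus_1)

lemma dbr_skew:
  assumes "\<xi> \<in> D" "\<eta> \<in> D" "\<zeta> \<in> D"
  shows "dbr \<eta> \<xi> \<zeta> = - dbr \<xi> \<eta> \<zeta>" "dbr \<xi> \<zeta> \<eta> = - dbr \<xi> \<eta> \<zeta>"
  using coalg assms unfolding adm_tp3_coalgebra_def three_lie_coalgebra_def skew3_on_def by blast+

lemma dm_commute: "dm \<eta> \<xi> = dm \<xi> \<eta>"
proof -
  have "swap_factors 0 1 (\<Delta> x) = \<Delta> x" for x
    using coalg by (simp add: adm_tp3_coalgebra_def cocomm_coassoc_coalgebra_def)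
  from fun_cong[OF this, of _ "[\<xi>, \<eta>]"] show ?thesis
    by (simp add: fun_eq_iff transpose2_def swap_factors_def)
qed

lemma vspace_dual: "vspace fun_scale D"
proof -
  interpret F: vector_space fun_scale by (rule vector_space_fun_scale)
  show ?thesis
    by (simp add: vspace_def vector_space_fun_scale F.subspace_def dual_closed)
qed

text \<open>Each coalgebra axiom, evaluated at a list of functionals, is the corresponding axiom of
  the transposed operation.\<close>

lemma dual_algebra: "adm_tp3_algebra fun_scale D dm dbr"
proof -
  have coassoc: "factor_comult s 0 2 \<Delta> (\<Delta> x) = factor_comult s 1 2 \<Delta> (\<Delta> x)"
    and colie: "factor_comult s 0 3 \<delta> (\<delta> x)
        + swap_factors 1 2 (swap_factors 0 1 (factor_comult s 1 3 \<delta> (\<delta> x)))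
        + swap_factors 0 2 (swap_factors 1 3 (factor_comult s 2 3 \<delta> (\<delta> x)))
        = factor_comult s 2 3 \<delta> (\<delta> x)"
    and ann: "factor_comult s 0 2 \<Delta> (\<delta> x) = 0" "factor_comult s 1 3 \<delta> (\<Delta> x) = 0" for x
    using coalg
    by (simp_all add: adm_tp3_coalgebra_def cocomm_coassoc_coalgebra_def three_lie_coalgebra_def)
  have "dm (dm \<xi> \<eta>) \<zeta> = dm \<xi> (dm \<eta> \<zeta>)" if "\<xi> \<in> D" "\<eta> \<in> D" "\<zeta> \<in> D" for \<xi> \<eta> \<zeta>
    using fun_cong[OF coassoc, of _ "[\<xi>, \<eta>, \<zeta>]"] that
    by (auto simp: factor_comult_def transpose2_def fun_eq_iff)
  then have assoc: "comm_assoc_algebra fun_scale D dm"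
    using vspace_dual by (auto simp: comm_assoc_algebra_def linear_on_def dm_closed dm dm_commute)
  \<comment> \<open>The two pairs of swaps rearrange \<open>[x1, x2, x3, x4, x5]\<close> to
    \<open>[x3, x1, x2, x4, x5]\<close> and \<open>[x3, x4, x1, x2, x5]\<close>, which produces
    exactly the second and third terms on the right.\<close>
  have FI: "dbr x1 x2 (dbr x3 x4 x5)
      = dbr (dbr x1 x2 x3) x4 x5 + dbr x3 (dbr x1 x2 x4) x5 + dbr x3 x4 (dbr x1 x2 x5)"
    if "x1 \<in> D" "x2 \<in> D" "x3 \<in> D" "x4 \<in> D" "x5 \<in> D" for x1 x2 x3 x4 x5
    using fun_cong[OF colie, of _ "[x1, x2, x3, x4, x5]"] that
    by (auto simp: factor_comult_def swap_factors_def transpose3_def fun_eq_iff)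
  have "trilinear_on fun_scale D dbr"
    by (simp add: trilinear_on_def linear_on_def dbr_closed dbr)
  moreover have "skew3_on D dbr"
    unfolding skew3_on_def using dbr_skew by blast
  ultimately have "three_lie_algebra fun_scale D dbr"
    unfolding three_lie_algebra_def by (intro conjI ballI vspace_dual FI)
  moreover have "dm \<xi> (dbr \<eta> \<zeta> \<theta>) = 0 \<and> dbr (dm \<xi> \<eta>) \<zeta> \<theta> = 0"
    if "\<xi> \<in> D" "\<eta> \<in> D" "\<zeta> \<in> D" "\<theta> \<in> D" for \<xi> \<eta> \<zeta> \<theta>
    using fun_cong[OF ann(1), of _ "[\<xi>, \<eta>, \<zeta>, \<theta>]"] fun_cong[OF ann(2), of _ "[\<xi>, \<eta>, \<zeta>, \<theta>]"] that
    by (auto simp: factor_comult_def transpose2_def transpose3_def fun_eq_iff)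
  ultimately show ?thesis using assoc by (simp add: adm_tp3_algebra_def)
qed

subsection \<open>Bialgebra identities paired with functionals\<close>

text \<open>The two coadjoint actions of the dual algebra on the original space, \<open>M\<close>
  with the sign it has in the matched pair.\<close>

abbreviation "R \<equiv> codual_rep2 s dbr"
abbreviation "M \<equiv> \<lambda>\<xi> x. - codual_rep1 s dm \<xi> x"

text \<open>The right-hand side is linear in \<open>\<zeta>\<close>, so it is evaluation at a vector
  of the finite-dimensional space. From here on \<open>R\<close> enters only through this formula,
  and \<open>M\<close> through its analogue below.\<close>

lemma dual_codual_rep2:
  assumes "\<xi> \<in> D" "\<eta> \<in> D" "\<zeta> \<in> D"
  shows "\<zeta> (R \<xi> \<eta> x) = - dbr \<xi> \<eta> \<zeta> x"
  unfolding codual_rep2_def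
  by (subst from_bidual[OF fd _ _ assms(3)])
    (auto simp: dual_rep2_def dbr[OF _ _ assms(1,2)] fun_scale_apply assms)

lemma dual_codual_rep1:
  assumes "\<xi> \<in> D" "\<zeta> \<in> D"
  shows "\<zeta> (codual_rep1 s dm \<xi> x) = - dm \<xi> \<zeta> x"
  unfolding codual_rep1_def
  by (subst from_bidual[OF fd _ _ assms(2)])
    (auto simp: dual_rep1_def dm[OF _ _ assms(1)] fun_scale_apply assms)

lemma dual_rep_transpose:
  "dual_rep2 br x y \<xi> = - ad_transpose \<xi> x y" "- dual_rep1 m x \<xi> = mult_transpose \<xi> x"
  by (simp_all add: dual_rep2_def dual_rep1_def ad_transpose_def mult_transpose_def fun_eq_iff)

lemma mult_transpose_codual:
  assumes "a \<in> D" "b \<in> D"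
  shows "b (m (codual_rep1 s dm a x) y) = - dm a (mult_transpose b y) x"
  using dual_codual_rep1[OF assms(1) transpose_closed(2)[OF assms(2)], of y x]
  by (simp add: mult_transpose_def m_commute[of y])

text \<open>A functional composed with ad is again a functional, so the pairing formula for
  \<open>R\<close> applies to it. Cyclicity brings the entry with \<open>R\<close> to the last slot;
  from the middle slot this exchanges the other two arguments.\<close>

lemma ad_transpose_codual:
  assumes "a \<in> D" "b \<in> D" "c \<in> D"
  shows "c (br (R a b x) y z) = - dbr a b (ad_transpose c y z) x"
    "c (br y (R a b x) z) = - dbr a b (ad_transpose c z y) x"
    "c (br y z (R a b x)) = - dbr a b (ad_transpose c y z) x"
proof -
  have *: "c (br y z (R a b x)) = - dbr a b (ad_transpose c y z) x" for y z
    using dual_codual_rep2[OF assms(1,2) transpose_closed(1)[OF assms(3)], of y z x]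
    by (simp add: ad_transpose_def)
  then show "c (br y z (R a b x)) = - dbr a b (ad_transpose c y z) x" .
  show "c (br (R a b x) y z) = - dbr a b (ad_transpose c y z) x"
    unfolding *[symmetric] by (subst br_cyclic) simp
  show "c (br y (R a b x) z) = - dbr a b (ad_transpose c z y) x"
    unfolding *[symmetric] by (subst br_cyclic, subst br_cyclic) simp
qed

lemma mult_transpose_codual_rep2:
  assumes "a \<in> D" "b \<in> D" "c \<in> D"
  shows "c (m (R a b x) y) = - dbr a b (mult_transpose c y) x"
  using dual_codual_rep2[OF assms(1,2) transpose_closed(2)[OF assms(3)], of y x]
  by (simp add: mult_transpose_def m_commute[of y])

lemma ad_transpose_codual_rep1:
  assumes "a \<in> D" "c \<in> D"
  shows "c (br (codual_rep1 s dm a x) y z) = - dm a (ad_transpose c y z) x"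
proof -
  have "c (br y z (codual_rep1 s dm a x)) = - dm a (ad_transpose c y z) x"
    using dual_codual_rep1[OF assms(1) transpose_closed(1)[OF assms(2)], of y z x]
    by (simp add: ad_transpose_def)
  then show ?thesis by (simp only: br_cyclic[of _ y z])
qed

text \<open>Condition (D1) paired with three functionals; \<open>bracket_derivation_one\<close> is
  (D2) in the same form.\<close>

definition "bracket_derivation_all \<longleftrightarrow> (\<forall>x y z. \<forall>a\<in>D. \<forall>b\<in>D. \<forall>c\<in>D.
  dbr a b c (br x y z) = dbr a b (ad_transpose c y z) x + dbr a b (ad_transpose c z x) y
    + dbr a b (ad_transpose c x y) z)"

definition "bracket_derivation_one \<longleftrightarrow> (\<forall>x y z. \<forall>a\<in>D. \<forall>b\<in>D. \<forall>c\<in>D.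
  dbr a b c (br x y z) = dbr a b (ad_transpose c y z) x + dbr a (ad_transpose b y z) c x
    + dbr (ad_transpose a y z) b c x)"

definition "infinitesimal_compatible \<longleftrightarrow> (\<forall>x y. \<forall>a\<in>D. \<forall>b\<in>D.
  dm a b (m x y) = dm (mult_transpose a x) b y + dm a (mult_transpose b y) x)"

text \<open>Six vanishing conditions of a bialgebra become four here: by the symmetry of
  \<open>dm\<close> and \<open>dbr\<close>, acting on the first factor and acting on the last one
  give the same condition.\<close>

definition "mixed_vanishing \<longleftrightarrow>
  (\<forall>x y z. \<forall>a\<in>D. \<forall>b\<in>D. dm a b (br x y z) = 0) \<and>
  (\<forall>x y. \<forall>a\<in>D. \<forall>b\<in>D. \<forall>c\<in>D. dbr a b c (m x y) = 0) \<and>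
  (\<forall>x y z. \<forall>a\<in>D. \<forall>b\<in>D. dm (ad_transpose a y z) b x = 0) \<and>
  (\<forall>x y. \<forall>a\<in>D. \<forall>b\<in>D. \<forall>c\<in>D. dbr a b (mult_transpose c y) x = 0)"

section \<open>Reduction of the tensor identities to scalar identities\<close>

lemma tensor_eq_iff:
  assumes "\<And>\<xi>s. \<not> (length \<xi>s = n \<and> set \<xi>s \<subseteq> D) \<Longrightarrow> t \<xi>s = 0"
    and "\<And>\<xi>s. \<not> (length \<xi>s = n \<and> set \<xi>s \<subseteq> D) \<Longrightarrow> u \<xi>s = 0"
  shows "n = 2 \<Longrightarrow> t = u \<longleftrightarrow> (\<forall>a\<in>D. \<forall>b\<in>D. t [a, b] = u [a, b])"
    and "n = 3 \<Longrightarrow> t = u \<longleftrightarrow> (\<forall>a\<in>D. \<forall>b\<in>D. \<forall>c\<in>D. t [a, b, c] = u [a, b, c])"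
proof -
  have eq: "t = u \<longleftrightarrow> (\<forall>\<xi>s. length \<xi>s = n \<and> set \<xi>s \<subseteq> D \<longrightarrow> t \<xi>s = u \<xi>s)"
    by (metis assms ext)
  show "t = u \<longleftrightarrow> (\<forall>a\<in>D. \<forall>b\<in>D. t [a, b] = u [a, b])" if "n = 2"
    unfolding eq by (auto simp: that numeral_2_eq_2 length_Suc_conv)
  show "t = u \<longleftrightarrow> (\<forall>a\<in>D. \<forall>b\<in>D. \<forall>c\<in>D. t [a, b, c] = u [a, b, c])" if "n = 3"
    unfolding eq by (auto simp: that numeral_3_eq_3 length_Suc_conv)
qed

text \<open>Updating a list keeps its length, so a wrong length is detected by \<open>t\<close>;
  entries outside \<open>D\<close> are detected by the test in \<open>factor_map\<close>.\<close>

lemma factor_map_eq_0: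
  assumes "t \<in> tensor_power s n" "\<not> (length \<xi>s = n \<and> set \<xi>s \<subseteq> D)"
  shows "factor_map s i \<phi> t \<xi>s = 0"
  using assms tensor_power_eq_0[OF assms(1), of "\<xi>s[i := \<lambda>x. (\<xi>s ! i) (\<phi> x)]"]
  by (auto simp: factor_map_def)

lemmas coalgebra_eq_0 = tensor_power_eq_0[OF tensor_coalgebra(1)] tensor_power_eq_0[OF tensor_coalgebra(2)]
  factor_map_eq_0[OF tensor_coalgebra(1)] factor_map_eq_0[OF tensor_coalgebra(2)]

lemma bialgebra_iff:
  "dc_adm_tp3_bialgebra s m br \<Delta> \<delta> \<longleftrightarrow> bracket_derivation_all \<and> bracket_derivation_one \<and>
    infinitesimal_compatible \<and> mixed_vanishing"
proof -
  have all: "(\<forall>x y z. \<delta> (br x y z) = factor_map s 2 (br y z) (\<delta> x) + factor_map s 2 (br z x) (\<delta> y)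
        + factor_map s 2 (br x y) (\<delta> z)) \<longleftrightarrow> bracket_derivation_all"
    unfolding bracket_derivation_all_def
    by (subst tensor_eq_iff(2)[where n = 3])
      (simp_all add: coalgebra_eq_0, simp add: factor_map_def transpose3_def ad_transpose_def)
  have one: "(\<forall>x y z. \<delta> (br x y z) = factor_map s 2 (br y z) (\<delta> x) + factor_map s 1 (br y z) (\<delta> x)
        + factor_map s 0 (br y z) (\<delta> x)) \<longleftrightarrow> bracket_derivation_one"
    unfolding bracket_derivation_one_def
    by (subst tensor_eq_iff(2)[where n = 3])
      (simp_all add: coalgebra_eq_0, simp add: factor_map_def transpose3_def ad_transpose_def)
  have inf: "(\<forall>x y. \<Delta> (m x y) = factor_map s 0 (m x) (\<Delta> y) + factor_map s 1 (m y) (\<Delta> x))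
      \<longleftrightarrow> infinitesimal_compatible"
    unfolding infinitesimal_compatible_def
    by (subst tensor_eq_iff(1)[where n = 2])
      (simp_all add: coalgebra_eq_0, simp add: factor_map_def transpose2_def mult_transpose_def)
  have 1: "(\<forall>x y z. \<Delta> (br x y z) = 0) \<longleftrightarrow> (\<forall>x y z. \<forall>a\<in>D. \<forall>b\<in>D. dm a b (br x y z) = 0)"
    by (subst tensor_eq_iff(1)[where n = 2]) (simp_all add: coalgebra_eq_0, simp add: transpose2_def)
  have 2: "(\<forall>x y. \<delta> (m x y) = 0) \<longleftrightarrow> (\<forall>x y. \<forall>a\<in>D. \<forall>b\<in>D. \<forall>c\<in>D. dbr a b c (m x y) = 0)"
    by (subst tensor_eq_iff(2)[where n = 3]) (simp_all add: coalgebra_eq_0, simp add: transpose3_def)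
  have 3: "(\<forall>x y z. factor_map s 0 (br y z) (\<Delta> x) = 0)
      \<longleftrightarrow> (\<forall>x y z. \<forall>a\<in>D. \<forall>b\<in>D. dm (ad_transpose a y z) b x = 0)"
    by (subst tensor_eq_iff(1)[where n = 2])
      (simp_all add: coalgebra_eq_0, simp add: factor_map_def transpose2_def ad_transpose_def)
  have 4: "(\<forall>x y z. factor_map s 1 (br y z) (\<Delta> x) = 0)
      \<longleftrightarrow> (\<forall>x y z. \<forall>a\<in>D. \<forall>b\<in>D. dm b (ad_transpose a y z) x = 0)"
    by (subst tensor_eq_iff(1)[where n = 2])
      (simp_all add: coalgebra_eq_0, auto simp: factor_map_def transpose2_def ad_transpose_def)
  have 5: "(\<forall>x y. factor_map s 2 (m y) (\<delta> x) = 0)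
      \<longleftrightarrow> (\<forall>x y. \<forall>a\<in>D. \<forall>b\<in>D. \<forall>c\<in>D. dbr a b (mult_transpose c y) x = 0)"
    by (subst tensor_eq_iff(2)[where n = 3])
      (simp_all add: coalgebra_eq_0, simp add: factor_map_def transpose3_def mult_transpose_def)
  have 6: "(\<forall>x y. factor_map s 0 (m y) (\<delta> x) = 0)
      \<longleftrightarrow> (\<forall>x y. \<forall>c\<in>D. \<forall>a\<in>D. \<forall>b\<in>D. dbr (mult_transpose c y) a b x = 0)"
    by (subst tensor_eq_iff(2)[where n = 3])
      (simp_all add: coalgebra_eq_0, simp add: factor_map_def transpose3_def mult_transpose_def)
  \<comment> \<open>Moving the first slot to the end is an even permutation, so the condition in
    \<open>6\<close> is the one in \<open>5\<close>. Likewise \<open>4\<close> is \<open>3\<close>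
    by commutativity of \<open>dm\<close>.\<close>
  have rot: "dbr (mult_transpose c y) a b x = dbr a b (mult_transpose c y) x"
    if "a \<in> D" "b \<in> D" "c \<in> D" for a b c x y
    using that dbr_skew(1)[of a "mult_transpose c y" b] dbr_skew(2)[of a b "mult_transpose c y"]
    by (simp add: transpose_closed)
  have base: "three_lie_algebra s UNIV br" "three_lie_coalgebra s \<delta>" "comm_assoc_algebra s UNIV m"
    "cocomm_coassoc_coalgebra s \<Delta>"
    using alg coalg by (auto simp: adm_tp3_algebra_def adm_tp3_coalgebra_def)
  show ?thesis
    unfolding dc_adm_tp3_bialgebra_def dc_three_lie_bialgebra_def comm_cocomm_inf_bialgebra_def
      all one inf 1 2 3 4 5 6 mixed_vanishing_def
    using rot dm_commute base alg coalg by auto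
qed

subsection \<open>Matched pairs\<close>

text \<open>The same pairing read in both directions, for the action on the dual and for the action
  of the dual. Separation is equality of functions here and the existence of enough functionals in
  \<open>predual\<close>.\<close>

sublocale primal: dual_pairing s UNIV fun_scale D "\<lambda>x \<xi>. \<xi> x"
proof unfold_locales
  show "vspace s UNIV" "vspace fun_scale D"
    using vspace_dual by (simp_all add: vspace_def vector_space_axioms)
qed (simp_all add: dual fun_scale_apply fun_eq_iff)

sublocale predual: dual_pairing fun_scale D s UNIV "\<lambda>\<xi> x. \<xi> x"
proof unfold_locales
  show "vspace s UNIV" "vspace fun_scale D" using primal.V primal.W .
qed (simp_all add: dual fun_scale_apply, rule separating)

lemma coadjoint_rep_dual: "adm_tp3_rep s UNIV m br fun_scale D (dual_rep2 br) (\<lambda>x \<xi>. - dual_rep1 m x \<xi>)"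
  by (rule primal.coadjoint_adm_tp3_rep)
    (simp_all add: alg dual_rep_transpose transpose_closed dual_closed,
      simp_all add: ad_transpose_def mult_transpose_def)

lemma coadjoint_rep_primal: "adm_tp3_rep fun_scale D dm dbr s UNIV R M"
  by (rule predual.coadjoint_adm_tp3_rep)
    (simp_all add: dual_algebra dual dual_codual_rep1 dual_codual_rep2)

section \<open>The matching conditions of the 3-Lie brackets\<close>

lemma bracket_derivation_allD:
  "bracket_derivation_all \<Longrightarrow> a \<in> D \<Longrightarrow> b \<in> D \<Longrightarrow> c \<in> D \<Longrightarrow>
    dbr a b c (br x y z) = dbr a b (ad_transpose c y z) x + dbr a b (ad_transpose c z x) y
    + dbr a b (ad_transpose c x y) z"
  unfolding bracket_derivation_all_def by blast

lemma bracket_derivation_oneD: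
  "bracket_derivation_one \<Longrightarrow> a \<in> D \<Longrightarrow> b \<in> D \<Longrightarrow> c \<in> D \<Longrightarrow>
    dbr a b c (br x y z) = dbr a b (ad_transpose c y z) x + dbr a (ad_transpose b y z) c x
    + dbr (ad_transpose a y z) b c x"
  unfolding bracket_derivation_one_def by blast

lemma dbr_cyclic:
  assumes "a \<in> D" "b \<in> D" "c \<in> D"
  shows "dbr a b c = dbr b c a"
  using dbr_skew(1)[OF assms] dbr_skew(2)[of b a c] assms by simp

lemma three_lie_matching_primal_iff:
  "three_lie_matching UNIV br D (dual_rep2 br) R \<longleftrightarrow> bracket_derivation_all \<and> bracket_derivation_one"
proof
  assume A: "three_lie_matching UNIV br D (dual_rep2 br) R"
  have "bracket_derivation_all"
    unfolding bracket_derivation_all_def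
  proof (intro allI ballI)
    fix x y z a b c assume D: "a \<in> D" "b \<in> D" "c \<in> D"
    have "R a b (br x y z) = br (R a b x) y z + br x (R a b y) z + br x y (R a b z)"
      using A D unfolding three_lie_matching_def by blast
    from arg_cong[OF this, of c] D show "dbr a b c (br x y z) = dbr a b (ad_transpose c y z) x
        + dbr a b (ad_transpose c z x) y + dbr a b (ad_transpose c x y) z"
      by (simp add: dual dual_codual_rep2 ad_transpose_codual) algebra
  qed
  moreover have "bracket_derivation_one"
    unfolding bracket_derivation_one_def
  proof (intro allI ballI)
    fix x y z a b c assume D: "a \<in> D" "b \<in> D" "c \<in> D"
    have "br (R a b x) y z = R a b (br x y z) + R (dual_rep2 br y z a) b x + R a (dual_rep2 br y z b) x"
      using A D unfolding three_lie_matching_def by blast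
    from arg_cong[OF this, of c] D show "dbr a b c (br x y z) = dbr a b (ad_transpose c y z) x
        + dbr a (ad_transpose b y z) c x + dbr (ad_transpose a y z) b c x"
      by (simp add: dual dual_codual_rep2 ad_transpose_codual dual_rep_transpose transpose_closed
          dual_closed dbr_minus) algebra
  qed
  ultimately show "bracket_derivation_all \<and> bracket_derivation_one" ..
next
  assume "bracket_derivation_all \<and> bracket_derivation_one"
  then have all: bracket_derivation_all and one: bracket_derivation_one by auto
  have 1: "R a b (br x y z) = br (R a b x) y z + br x (R a b y) z + br x y (R a b z)"
    if D: "a \<in> D" "b \<in> D" for a b x y z
    by (rule separating)
      (simp add: D dual dual_codual_rep2 ad_transpose_codual bracket_derivation_allD[OF all])
  have 2: "br (R a b x) y z = R a b (br x y z) + R (dual_rep2 br y z a) b x + R a (dual_rep2 br y z b) x"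
    if D: "a \<in> D" "b \<in> D" for a b x y z
    by (rule separating)
      (simp add: D dual dual_codual_rep2 ad_transpose_codual bracket_derivation_oneD[OF one]
        dual_rep_transpose transpose_closed dual_closed dbr_minus)
  have 3: "- R (dual_rep2 br x y a) b z
      = - R (dual_rep2 br x z b) a y + R (dual_rep2 br y z b) a x - br x y (R a b z)"
    if D: "a \<in> D" "b \<in> D" for a b x y z
  proof (rule separating)
    fix c assume c: "c \<in> D"
    note D = D c
    have sk: "ad_transpose b x z = - ad_transpose b z x" using D by (intro ad_transpose_skew)
    have sw: "dbr (ad_transpose b u v) a c = - dbr a (ad_transpose b u v) c" for u v
      using D by (intro dbr_skew) (auto simp: transpose_closed)
    \<comment> \<open>(D1) for the functionals \<open>a\<close>, \<open>c\<close>, \<open>b\<close>,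
      so that ad falls on \<open>b\<close>. Exchanging the last two slots changes the sign of every
      term and moves ad to the second slot; the term \<open>dbr a (ad_transpose b x y) c z\<close>
      is then common with (D2) and cancels.\<close>
    have "dbr a c b (br z x y) = dbr a c (ad_transpose b x y) z + dbr a c (ad_transpose b y z) x
        + dbr a c (ad_transpose b z x) y"
      using D by (intro bracket_derivation_allD[OF all])
    then have "dbr a b c (br z x y) = dbr a (ad_transpose b x y) c z + dbr a (ad_transpose b y z) c x
        + dbr a (ad_transpose b z x) c y"
      using D dbr_skew(2)[of a c] by (simp add: transpose_closed)
    moreover have "dbr a b c (br z x y) = dbr a b (ad_transpose c x y) z
        + dbr a (ad_transpose b x y) c z + dbr (ad_transpose a x y) b c z"
      using D by (intro bracket_derivation_oneD[OF one])
    ultimately show "c (- R (dual_rep2 br x y a) b z)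
      = c (- R (dual_rep2 br x z b) a y + R (dual_rep2 br y z b) a x - br x y (R a b z))"
      using D
      by (simp add: dual dual_codual_rep2 ad_transpose_codual
          dual_rep_transpose transpose_closed dual_closed dbr_minus sk sw) algebra
  qed
  show "three_lie_matching UNIV br D (dual_rep2 br) R"
    unfolding three_lie_matching_def by (intro conjI ballI 1 2 3)
qed

text \<open>An implication is enough, since the conditions with values in the original space already
  force (D1) and (D2). Passing to the dual exchanges their roles: the first matching condition is
  now (D2), the third is (D1), and the second is again their difference.\<close>

lemma three_lie_matching_dual:
  assumes all: bracket_derivation_all and one: bracket_derivation_one
  shows "three_lie_matching D dbr UNIV R (dual_rep2 br)"
proof -
  have 1: "dual_rep2 br x y (dbr a b c) = dbr (dual_rep2 br x y a) b c + dbr a (dual_rep2 br x y b) c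
      + dbr a b (dual_rep2 br x y c)"
    if D: "a \<in> D" "b \<in> D" "c \<in> D" for a b c x y
  proof (rule ext)
    fix z
    \<comment> \<open>The evaluation point \<open>z\<close> has to take the first place of the
      bracket, the one that (D2) singles out.\<close>
    have "br x y z = br z x y" by (simp only: br_cyclic[of z])
    then show "dual_rep2 br x y (dbr a b c) z = (dbr (dual_rep2 br x y a) b c + dbr a (dual_rep2 br x y b) c
      + dbr a b (dual_rep2 br x y c)) z"
      using bracket_derivation_oneD[OF one D, of z x y] D
      by (simp add: dual_rep_transpose transpose_closed dual_closed dbr_minus)
        (simp add: ad_transpose_def)
  qed
  have 2: "dbr (dual_rep2 br x y a) b c = dual_rep2 br x y (dbr a b c) + dual_rep2 br (R b c x) y a
      + dual_rep2 br x (R b c y) a"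
    if D: "a \<in> D" "b \<in> D" "c \<in> D" for a b c x y
  proof (rule ext)
    fix z
    \<comment> \<open>(D1) lets ad act on the last slot, so \<open>a\<close> is rotated there and
      back again.\<close>
    have "dbr b c a (br x y z) = dbr b c (ad_transpose a y z) x + dbr b c (ad_transpose a z x) y
        + dbr b c (ad_transpose a x y) z"
      using D by (intro bracket_derivation_allD[OF all])
    moreover have "dbr b c a (br x y z) = dbr a b c (br x y z)"
      "dbr b c (ad_transpose a x y) z = dbr (ad_transpose a x y) b c z"
      using D by (auto simp: dbr_cyclic[of _ b c] transpose_closed)
    ultimately show "dbr (dual_rep2 br x y a) b c z = (dual_rep2 br x y (dbr a b c)
        + dual_rep2 br (R b c x) y a + dual_rep2 br x (R b c y) a) z"
      using D
      by (simp add: dual_rep_transpose(1)[of x y a] transpose_closed dbr_minus)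
        (simp add: dual_rep2_def ad_transpose_codual)
  qed
  have 3: "- dual_rep2 br (R a b x) y c
      = - dual_rep2 br (R a c y) x b + dual_rep2 br (R b c y) x a - dbr a b (dual_rep2 br x y c)"
    if D: "a \<in> D" "b \<in> D" "c \<in> D" for a b c x y
  proof (rule ext)
    fix z
    \<comment> \<open>(D1) for this bracket and (D2) for its rotation with \<open>y\<close> in front
      share the term \<open>dbr a b (ad_transpose c z x) y\<close>; it cancels in the
      difference.\<close>
    have "dbr a b c (br z x y) = dbr a b (ad_transpose c x y) z + dbr a b (ad_transpose c y z) x
        + dbr a b (ad_transpose c z x) y"
      using D by (intro bracket_derivation_allD[OF all])
    moreover have "dbr a b c (br z x y) = dbr a b (ad_transpose c z x) y
        + dbr a (ad_transpose b z x) c y + dbr (ad_transpose a z x) b c y"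
      unfolding br_cyclic[of y, symmetric] using D by (intro bracket_derivation_oneD[OF one])
    moreover have "dbr a c (ad_transpose b x z) y = dbr a (ad_transpose b z x) c y"
      "dbr b c (ad_transpose a x z) y = - dbr (ad_transpose a z x) b c y"
      using D dbr_skew(2)[of a c "ad_transpose b z x"] dbr_cyclic[of "ad_transpose a z x" b c]
      by (simp_all add: ad_transpose_skew[of _ z x] transpose_closed dual_closed dbr_minus)
    ultimately show "(- dual_rep2 br (R a b x) y c) z
      = (- dual_rep2 br (R a c y) x b + dual_rep2 br (R b c y) x a - dbr a b (dual_rep2 br x y c)) z"
      using D
      by (simp add: dual_rep_transpose(1)[of x y c] transpose_closed dbr_minus)
        (simp add: dual_rep2_def ad_transpose_codual, algebra)
  qed
  show ?thesis
    unfolding three_lie_matching_def by (intro conjI ballI 1 2 3)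
qed

section \<open>The matching conditions of the commutative products\<close>

lemma mult_transpose_apply: "mult_transpose a x y = a (m x y)"
  by (simp add: mult_transpose_def)

lemma m_minus: "m (- x) y = - m x y"
  using m(3)[of "- 1"] by simp

lemma br_minus: "br (- x) y z = - br x y z"
  using br(2)[of "- 1"] by simp

text \<open>The condition with values in the dual, evaluated at \<open>y\<close>, and the one with
  values in the original space, paired with \<open>b\<close>, are the same scalar identity. They
  differ only in which variable serves as the test.\<close>

lemma comm_assoc_matched_pair_iff:
  "comm_assoc_matched_pair s UNIV m fun_scale D dm (\<lambda>x \<xi>. - dual_rep1 m x \<xi>) M
    \<longleftrightarrow> infinitesimal_compatible"
proof -
  have A: "- dual_rep1 m x (dm a b) = dm (- dual_rep1 m x a) b + - dual_rep1 m (M a x) b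
      \<longleftrightarrow> (\<forall>y. dm a b (m x y) = dm (mult_transpose a x) b y + dm a (mult_transpose b y) x)"
    if "a \<in> D" "b \<in> D" for a b x
    unfolding dual_rep_transpose fun_eq_iff
    using that by (simp add: mult_transpose_apply m_minus mult_transpose_codual dual)
  have B: "M a (m x y) = m (M a x) y + M (- dual_rep1 m x a) y
      \<longleftrightarrow> (\<forall>b\<in>D. dm a b (m x y) = dm (mult_transpose a x) b y + dm a (mult_transpose b y) x)"
    if "a \<in> D" for a x y
    unfolding dual_rep_transpose
    by (subst eq_iff_dual) (use that in \<open>simp add: dual dual_codual_rep1 m_minus mult_transpose_codual
      transpose_closed add.commute\<close>)
  have reps: "comm_assoc_rep s UNIV m fun_scale D (\<lambda>x \<xi>. - dual_rep1 m x \<xi>)"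
    "comm_assoc_rep fun_scale D dm s UNIV M"
    using coadjoint_rep_dual coadjoint_rep_primal by (auto simp: adm_tp3_rep_def)
  show ?thesis
    unfolding comm_assoc_matched_pair_def infinitesimal_compatible_def
    using reps by (simp only: A B cong: ball_cong) blast
qed

section \<open>The mixed conditions and the characterisation of matched pairs\<close>

lemma mixed_vanishingD:
  assumes mixed_vanishing "a \<in> D" "b \<in> D"
  shows "dm a b (br x y z) = 0" "dm (ad_transpose a y z) b x = 0" "dm b (ad_transpose a y z) x = 0"
  using assms dm_commute unfolding mixed_vanishing_def by metis+

text \<open>Skew-symmetry of \<open>dbr\<close> carries the vanishing from the last slot to the
  other two.\<close>

lemma mixed_vanishing3D:
  assumes mixed_vanishing and D: "a \<in> D" "b \<in> D" "c \<in> D"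
  shows "dbr a b c (m x y) = 0" "dbr a b (mult_transpose c y) x = 0"
    "dbr (mult_transpose c y) a b x = 0" "dbr a (mult_transpose c y) b x = 0"
proof -
  show "dbr a b c (m x y) = 0" using assms unfolding mixed_vanishing_def by blast
  show 1: "dbr a b (mult_transpose c y) x = 0" using assms unfolding mixed_vanishing_def by blast
  show "dbr (mult_transpose c y) a b x = 0"
    using 1 D dbr_cyclic[of "mult_transpose c y" a b] by (simp add: transpose_closed)
  show "dbr a (mult_transpose c y) b x = 0"
    using 1 D dbr_skew(2)[of a b "mult_transpose c y"] by (simp add: transpose_closed)
qed

lemma matched_pair_iff:
  "adm_tp3_matched_pair s UNIV m br fun_scale D dm dbr (dual_rep2 br) (\<lambda>x \<xi>. - dual_rep1 m x \<xi>) R M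
    \<longleftrightarrow> bracket_derivation_all \<and> bracket_derivation_one \<and> infinitesimal_compatible \<and> mixed_vanishing"
    (is "?L \<longleftrightarrow> ?R")
proof
  assume L: ?L
  have "mixed_vanishing"
    unfolding mixed_vanishing_def
  proof (intro conjI allI ballI)
    \<comment> \<open>Four of the mixed conditions are selected, one for each conjunct of
      \<open>mixed_vanishing\<close>; pairing with one more functional, or evaluating at a vector,
      turns each into its scalar form.\<close>
    fix x y z a b c assume D: "a \<in> D" "b \<in> D"
    have "M a (br x y z) = 0" using L D by (simp add: adm_tp3_matched_pair_def)
    from arg_cong[OF this, of b] D show "dm a b (br x y z) = 0" by (simp add: dual dual_codual_rep1)
    have "M (dual_rep2 br y z a) x = 0" using L D by (simp add: adm_tp3_matched_pair_def)
    from arg_cong[OF this, of b] D show "dm (ad_transpose a y z) b x = 0"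
      by (simp add: dual dual_codual_rep1 dual_rep_transpose transpose_closed dual_closed dm_minus)
    assume c: "c \<in> D"
    have "R a b (m x y) = 0" using L D by (simp add: adm_tp3_matched_pair_def)
    from arg_cong[OF this, of c] D c show "dbr a b c (m x y) = 0" by (simp add: dual dual_codual_rep2)
    have "dbr (- dual_rep1 m y c) a b = 0" using L D c by (simp add: adm_tp3_matched_pair_def)
    then show "dbr a b (mult_transpose c y) x = 0"
      using D c dbr_cyclic[of "mult_transpose c y" a b]
      by (simp add: dual_rep_transpose transpose_closed)
  qed
  moreover have "bracket_derivation_all \<and> bracket_derivation_one \<and> infinitesimal_compatible"
    using L comm_assoc_matched_pair_iff three_lie_matching_primal_iff
    unfolding adm_tp3_matched_pair_def three_lie_matched_pair_def by blast
  ultimately show ?R by blast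
next
  assume R: ?R
  then have V: mixed_vanishing by blast
  note V2 = mixed_vanishingD[OF V] and V3 = mixed_vanishing3D[OF V]
  have "three_lie_matched_pair s UNIV br fun_scale D dbr (dual_rep2 br) R"
    using R three_lie_matching_primal_iff three_lie_matching_dual coadjoint_rep_dual coadjoint_rep_primal
    unfolding three_lie_matched_pair_def adm_tp3_rep_def by blast
  \<comment> \<open>These mixed conditions combine the bracket of the algebra with the product of
    the dual and reduce to values of \<open>dm\<close>. The next group combines the product with the
    dual bracket and reduces to values of \<open>dbr\<close>. The last identity of a matched pair
    contributes one condition to each group.\<close>
  moreover have "M a (br x y z) = 0" "dual_rep2 br x y (dm a b) = 0" "M (dual_rep2 br x y a) z = 0"
    "br (M a x) y z = 0" "dual_rep2 br (M a x) y b = 0" if "a \<in> D" "b \<in> D" for a b x y z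
  proof -
    show "M a (br x y z) = 0" "M (dual_rep2 br x y a) z = 0" "br (M a x) y z = 0"
      using that by (auto intro!: separating simp: dual dual_codual_rep1 dual_rep_transpose
          transpose_closed dual_closed dm_minus br_minus ad_transpose_codual_rep1 V2)
    show "dual_rep2 br x y (dm a b) = 0" "dual_rep2 br (M a x) y b = 0"
      using that by (auto simp: fun_eq_iff dual_rep2_def br_minus dual ad_transpose_codual_rep1 V2)
  qed
  moreover have "- dual_rep1 m x (dbr a b c) = 0" "R a b (m x y) = 0" "- dual_rep1 m (R a b x) c = 0"
    "dbr (- dual_rep1 m x a) b c = 0" "R a (- dual_rep1 m x b) y = 0"
    if "a \<in> D" "b \<in> D" "c \<in> D" for a b c x y
  proof -
    show "R a b (m x y) = 0" "R a (- dual_rep1 m x b) y = 0"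
      using that by (auto intro!: separating simp: dual dual_codual_rep2 dual_rep_transpose
          transpose_closed V3)
    show "- dual_rep1 m x (dbr a b c) = 0" "- dual_rep1 m (R a b x) c = 0"
      "dbr (- dual_rep1 m x a) b c = 0"
      using that by (auto simp: fun_eq_iff dual_rep_transpose mult_transpose_apply
          mult_transpose_codual_rep2 V3 simp flip: mult_transpose_def)
  qed
  ultimately show ?L
    unfolding adm_tp3_matched_pair_def
    using R alg dual_algebra comm_assoc_matched_pair_iff coadjoint_rep_dual coadjoint_rep_primal
    by (intro conjI ballI) blast+
qed

end

theorem theorem6p12:
  fixes s :: "'f::field_char_0 \<Rightarrow> 'a::ab_group_add \<Rightarrow> 'a"
    and Basis :: "'a set"
    and m :: "'a \<Rightarrow> 'a \<Rightarrow> 'a"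
    and br :: "'a \<Rightarrow> 'a \<Rightarrow> 'a \<Rightarrow> 'a"
    and \<Delta> \<delta> :: "'a \<Rightarrow> ('f, 'a) tensor"
  assumes "finite_dimensional_vector_space s Basis"
    and "adm_tp3_algebra s UNIV m br"
    and "adm_tp3_coalgebra s \<Delta> \<delta>"
  shows "adm_tp3_matched_pair
           s UNIV m br
           fun_scale (dual_space s) (transpose2 \<Delta>) (transpose3 \<delta>)
           (dual_rep2 br) (\<lambda>x \<xi>. - dual_rep1 m x \<xi>)
           (codual_rep2 s (transpose3 \<delta>)) (\<lambda>\<xi> x. - codual_rep1 s (transpose2 \<Delta>) \<xi> x)
         \<longleftrightarrow> dc_adm_tp3_bialgebra s m br \<Delta> \<delta>"
proof -
  interpret adm_tp3_algebra_coalgebra s Basis m br \<Delta> \<delta> using assms by (rule adm_tp3_algebra_coalgebra.intro)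
  show ?thesis
    using matched_pair_iff bialgebra_iff by simp
qed

end
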